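(* Let $p(D)=\partial_{x_1}-\alpha\partial_{x_2}$ be a vector field on $\mathbb{T}^2$, where $\alpha\in\mathbb{C}$. Then: (i) If $\operatorname{Im}(\alpha)\neq 0$, then $\operatorname{ind}_{GH}(p(D))=\operatorname{ind}_{GS}(p(D))=0$. Moreover, $p(D)$ is both GH-$0$ and GS-$0$. (ii) If $\alpha\in\mathbb{Q}$, then $\operatorname{ind}_{GH}(p(D))=\infty$ and $\operatorname{ind}_{GS}(p(D))=1$. Moreover, $p(D)$ is GS-$1$. (iii) If $\alpha\in\mathbb{R}\setminus\mathbb{Q}$, then $\operatorname{ind}_{GH}(p(D))=\operatorname{ind}_{GS}(p(D))=\mu(\alpha)$. Moreover, if $\alpha$ is an algebraic number of degree $2$, then $p(D)$ is both GH-$2$ and GS-$2$.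
   Context: $\mathbb{T}^2=(\mathbb{R}/2\pi\mathbb{Z})^2$, and $\mathscr{D}'(\mathbb{T}^2)$ is its space of distributions. For $k\in\mathbb{R}$, $H^k(\mathbb{T}^2)$ is the set of $u\in\mathscr{D}'(\mathbb{T}^2)$ with $\sum_{\xi\in\mathbb{Z}^2}(1+\|\xi\|^2)^k|\widehat{u}(\xi)|^2<\infty$, where $\|\xi\|$ is the Euclidean norm and $\widehat{u}(\xi)$ are the Fourier coefficients. The operator $p(D)$ is a Fourier multiplier with symbol $p(\xi)=i(\xi_1-\alpha\xi_2)$, of intrinsic order $m=1$. For $r\ge0$: - $p(D)$ is GH-$r$ (globally hypoelliptic with loss of $r$ derivatives) if for every $k\in\mathbb{R}$: $u\in\mathscr{D}'(\mathbb{T}^2)$ and $p(D)u\in H^k(\mathbb{T}^2)$ imply $u\in H^{k+1-r}(\mathbb{T}^2)$. - $p(D)$ is GS-$r$ (globally solvable with a loss of $r$ derivatives) if for every $k\in\mathbb{R}$ and every $f\in H^k(\mathbb{T}^2)\cap(\ker{}^tp(D)\cap C^\infty(\mathbb{T}^2))^0$ there is $u\in H^{k+1-r}(\mathbb{T}^2)$ with $p(D)u=f$. Here ${}^tp(D)$ is the transpose (the Fourier multiplier with symbol $p(-\xi)$), and $E^0$ is the set of distributions $f$ with $\langle f,\phi\rangle=0$ for all $\phi\in E$ (bilinear duality bracket). - $\operatorname{ind}_{GH}(p(D))=\inf\{r\ge0: p(D)\text{ is GH-}r\}$ and $\operatorname{ind}_{GS}(p(D))=\inf\{r\ge0: p(D)\text{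 is GS-}r\}$, with $\inf\emptyset=\infty$. The irrationality measure $\mu(\alpha)\in(0,\infty]$ of a real number $\alpha$ is the infimum of all real $\mu>0$ such that $0<|\alpha-\frac{\xi_1}{\xi_2}|<\frac1{|\xi_2|^\mu}$ has at most finitely many solutions $\xi_1/\xi_2$, with $\xi_1,\xi_2\in\mathbb{Z}$, $\xi_2\ne0$ ($\mu(\alpha)=\infty$ if there is no such $\mu$). The degree of an algebraic number is the smallest degree of a nonzero integer polynomial vanishing at it. *)

theory Defs
  imports "HOL-Analysis.Analysis" "HOL-Computational_Algebra.Polynomial"
begin

text \<open>
  Functions on the torus \<open>(\<real>/2\<pi>\<int>)\<^sup>2\<close> are represented by functions on the plane that are
  \<open>2\<pi>\<close>-periodic in each variable.
\<close>

subsection \<open>Smooth functions on the torus\<close>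

definition pdiff :: "real \<times> real \<Rightarrow> (real \<times> real \<Rightarrow> complex) \<Rightarrow> real \<times> real \<Rightarrow> complex"
  where "pdiff v f x = frechet_derivative f (at x) v"

definition pdiffs ::
    "(real \<times> real) list \<Rightarrow> (real \<times> real \<Rightarrow> complex) \<Rightarrow> real \<times> real \<Rightarrow> complex"
  where "pdiffs vs f = foldr pdiff vs f"

text \<open>
  Here \<open>Basis = {(1, 0), (0, 1)}\<close>, so \<open>vs \<in> lists Basis\<close> ranges over all words of partial
  derivatives. Since \<^const>\<open>frechet_derivative\<close> is only meaningful for differentiable functions,
  note that the condition at \<open>vs\<close> gives existence of the derivatives occurring in \<open>v # vs\<close>.
\<close>

definition smooth_torus :: "(real \<times> real \<Rightarrow> complex) set"
  where "smooth_torus =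
    {\<phi>. (\<forall>x y. \<phi> (x + 2 * pi, y) = \<phi> (x, y) \<and> \<phi> (x, y + 2 * pi) = \<phi> (x, y)) \<and>
        (\<forall>vs \<in> lists Basis. pdiffs vs \<phi> differentiable_on UNIV)}"

definition smooth_converges ::
    "(nat \<Rightarrow> real \<times> real \<Rightarrow> complex) \<Rightarrow> (real \<times> real \<Rightarrow> complex) \<Rightarrow> bool"
  where "smooth_converges F \<phi> \<longleftrightarrow>
    (\<forall>vs \<in> lists Basis. uniform_limit UNIV (\<lambda>n. pdiffs vs (F n)) (pdiffs vs \<phi>) sequentially)"

subsection \<open>Distributions on the torus\<close>

text \<open>
  Continuity is sequential continuity, which is continuity because the topology of the space of
  smooth functions is metrizable. Functionals are normalised to \<^const>\<open>undefined\<close> off the smooth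
  functions, so that equality of distributions is equality in HOL.
\<close>

type_synonym functional = "(real \<times> real \<Rightarrow> complex) \<Rightarrow> complex"

definition distributions :: "functional set"
  where "distributions =
    {u \<in> extensional smooth_torus.
       (\<forall>\<phi>\<in>smooth_torus. \<forall>\<psi>\<in>smooth_torus. u (\<lambda>x. \<phi> x + \<psi> x) = u \<phi> + u \<psi>) \<and>
       (\<forall>c. \<forall>\<phi>\<in>smooth_torus. u (\<lambda>x. c * \<phi> x) = c * u \<phi>) \<and>
       (\<forall>F. \<forall>\<phi>\<in>smooth_torus. (\<forall>n. F n \<in> smooth_torus) \<longrightarrow> smooth_converges F \<phi> \<longrightarrow>
          (\<lambda>n. u (F n)) \<longlonglongrightarrow> u \<phi>)}"

definition dist_deriv :: "real \<times> real \<Rightarrow> functional \<Rightarrow> functional"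
  where "dist_deriv v u = (\<lambda>\<phi>\<in>smooth_torus. - u (pdiff v \<phi>))"

definition annihilator :: "(real \<times> real \<Rightarrow> complex) set \<Rightarrow> functional set"
  where "annihilator E = {f \<in> distributions. \<forall>\<phi>\<in>E. f \<phi> = 0}"

definition character :: "int \<times> int \<Rightarrow> real \<times> real \<Rightarrow> complex"
  where "character \<xi> x = cis (of_int (fst \<xi>) * fst x + of_int (snd \<xi>) * snd x)"

definition fourier :: "functional \<Rightarrow> int \<times> int \<Rightarrow> complex"
  where "fourier u \<xi> = u (character (- \<xi>)) / (2 * of_real pi) ^ 2"

definition sobolev :: "real \<Rightarrow> functional set"
  where "sobolev k =
    {u \<in> distributions.
       (\<lambda>\<xi>. (1 + ((of_int (fst \<xi>))\<^sup>2 + (of_int (snd \<xi>))\<^sup>2)) powr k * (cmod (fourier u \<xi>))\<^sup>2)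
         summable_on UNIV}"

subsection \<open>The vector field and its transpose\<close>

definition vector_field :: "complex \<Rightarrow> functional \<Rightarrow> functional"
  where "vector_field \<alpha> u =
    (\<lambda>\<phi>\<in>smooth_torus. dist_deriv (1, 0) u \<phi> - \<alpha> * dist_deriv (0, 1) u \<phi>)"

definition vector_field_transpose ::
    "complex \<Rightarrow> (real \<times> real \<Rightarrow> complex) \<Rightarrow> real \<times> real \<Rightarrow> complex"
  where "vector_field_transpose \<alpha> \<phi> x = - pdiff (1, 0) \<phi> x + \<alpha> * pdiff (0, 1) \<phi> x"

definition smooth_kernel_transpose :: "complex \<Rightarrow> (real \<times> real \<Rightarrow> complex) set"
  where "smooth_kernel_transpose \<alpha> = {\<phi> \<in> smooth_torus. \<forall>x. vector_field_transpose \<alpha> \<phi> x = 0}"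

subsection \<open>Global hypoellipticity and solvability with loss of derivatives\<close>

text \<open>The summand 1 in the Sobolev exponents is the order of the vector field.\<close>

definition GH :: "complex \<Rightarrow> real \<Rightarrow> bool"
  where "GH \<alpha> r \<longleftrightarrow>
    (\<forall>k. \<forall>u\<in>distributions. vector_field \<alpha> u \<in> sobolev k \<longrightarrow> u \<in> sobolev (k + 1 - r))"

definition GS :: "complex \<Rightarrow> real \<Rightarrow> bool"
  where "GS \<alpha> r \<longleftrightarrow>
    (\<forall>k. \<forall>f \<in> sobolev k \<inter> annihilator (smooth_kernel_transpose \<alpha>).
       \<exists>u \<in> sobolev (k + 1 - r). vector_field \<alpha> u = f)"

definition ind_GH :: "complex \<Rightarrow> ereal"
  where "ind_GH \<alpha> = Inf {ereal r |r. 0 \<le> r \<and> GH \<alpha> r}"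

definition ind_GS :: "complex \<Rightarrow> ereal"
  where "ind_GS \<alpha> = Inf {ereal r |r. 0 \<le> r \<and> GS \<alpha> r}"

subsection \<open>Diophantine notions\<close>

text \<open>Approximations are counted as rational numbers, not as pairs of integers.\<close>

definition irrationality_measure :: "real \<Rightarrow> ereal"
  where "irrationality_measure a =
    Inf {ereal \<mu> |\<mu>. 0 < \<mu> \<and>
      finite {q. \<exists>m n :: int. n \<noteq> 0 \<and> q = of_int m / of_int n \<and>
        0 < \<bar>a - q\<bar> \<and> \<bar>a - q\<bar> < 1 / \<bar>of_int n\<bar> powr \<mu>}}"

text \<open>Only meaningful for algebraic numbers.\<close>

definition algebraic_degree :: "complex \<Rightarrow> nat"
  where "algebraic_degree x =
    (LEAST d. \<exists>p :: int poly. p \<noteq> 0 \<and> poly (map_poly of_int p) x = 0 \<and> degree p = d)"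

subsection \<open>The vector field as a Fourier multiplier\<close>

lemma character_has_derivative:
  "((\<lambda>x. c * character \<xi> x) has_derivative
     (\<lambda>v. (c * (\<i> * (of_int (fst \<xi>) * of_real (fst v) + of_int (snd \<xi>) * of_real (snd v))))
      * character \<xi> x)) (at x)"
proof -
  let ?h = "\<lambda>x :: real \<times> real. \<i> * (of_int (fst \<xi>) * of_real (fst x) + of_int (snd \<xi>) * of_real (snd x))"
  have "(?h has_derivative ?h) (at x)"
    by (intro has_derivative_mult_right has_derivative_add has_derivative_of_real
        has_derivative_fst has_derivative_snd has_derivative_ident)
  from has_derivative_compose[OF this DERIV_exp[unfolded has_field_derivative_def]]
  have "((\<lambda>x. c * exp (?h x)) has_derivative (\<lambda>v. c * (exp (?h x) * ?h v))) (at x)"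
    by (rule has_derivative_mult_right)
  moreover have "character \<xi> x = exp (?h x)" for x
    by (simp add: character_def cis_conv_exp)
  ultimately show ?thesis by (simp add: mult_ac)
qed

lemma pdiff_character:
  "pdiff v (\<lambda>x. c * character \<xi> x) =
    (\<lambda>x. (c * (\<i> * (of_int (fst \<xi>) * of_real (fst v) + of_int (snd \<xi>) * of_real (snd v))))
      * character \<xi> x)"
  unfolding pdiff_def by (intro ext) (simp only: frechet_derivative_at[OF character_has_derivative, symmetric])

lemma character_smooth: "character \<xi> \<in> smooth_torus"
proof -
  have "\<exists>c. pdiffs vs (character \<xi>) = (\<lambda>x. c * character \<xi> x)" for vs
  proof (induction vs)
    case Nil
    show ?case by (rule exI[of _ 1]) (simp add: pdiffs_def)
  next
    case (Cons v vs)
    then show ?case by (auto simp: pdiffs_def pdiff_character)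
  qed
  moreover have "(\<lambda>x. c * character \<xi> x) differentiable_on UNIV" for c
    unfolding differentiable_on_def differentiable_def
    using character_has_derivative by blast
  ultimately have "pdiffs vs (character \<xi>) differentiable_on UNIV" for vs
    by metis
  moreover have cis: "cis (t + 2 * pi * of_int n) = cis t" for t n
    by (simp add: cis_mult[symmetric] cis_multiple_2pi)
  have "character \<xi> (x + 2 * pi, y) = character \<xi> (x, y)" for x y
    using cis[of "of_int (fst \<xi>) * x + of_int (snd \<xi>) * y" "fst \<xi>"]
    by (simp add: character_def algebra_simps)
  moreover have "character \<xi> (x, y + 2 * pi) = character \<xi> (x, y)" for x y
    using cis[of "of_int (fst \<xi>) * x + of_int (snd \<xi>) * y" "snd \<xi>"]
    by (simp add: character_def algebra_simps)
  ultimately show ?thesis by (simp add: smooth_torus_def)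
qed

lemma smooth_torus_differentiable:
  assumes "\<phi> \<in> smooth_torus" "vs \<in> lists Basis"
  shows "pdiffs vs \<phi> differentiable (at x)"
proof -
  have "pdiffs vs \<phi> differentiable_on UNIV"
    using assms unfolding smooth_torus_def by blast
  then show ?thesis
    unfolding differentiable_on_def by blast
qed

lemma pdiff_lincomb:
  assumes "\<And>x. f differentiable (at x)" "\<And>x. g differentiable (at x)"
  shows "pdiff v (\<lambda>x. a * f x + b * g x) = (\<lambda>x. a * pdiff v f x + b * pdiff v g x)"
proof
  fix x
  have "((\<lambda>x. a * f x + b * g x) has_derivative
      (\<lambda>v. a * frechet_derivative f (at x) v + b * frechet_derivative g (at x) v)) (at x)"
    by (intro has_derivative_add has_derivative_mult_right
        assms[unfolded frechet_derivative_works])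
  from frechet_derivative_at[OF this, symmetric]
  show "pdiff v (\<lambda>x. a * f x + b * g x) x = a * pdiff v f x + b * pdiff v g x"
    unfolding pdiff_def by (rule fun_cong)
qed

lemma pdiffs_lincomb:
  assumes "\<phi> \<in> smooth_torus" "\<psi> \<in> smooth_torus" "vs \<in> lists Basis"
  shows "pdiffs vs (\<lambda>x. a * \<phi> x + b * \<psi> x) = (\<lambda>x. a * pdiffs vs \<phi> x + b * pdiffs vs \<psi> x)"
  using assms(3)
proof (induction vs)
  case Nil
  show ?case by (simp add: pdiffs_def)
next
  case (Cons v vs)
  have "pdiff v (\<lambda>x. a * pdiffs vs \<phi> x + b * pdiffs vs \<psi> x) =
      (\<lambda>x. a * pdiff v (pdiffs vs \<phi>) x + b * pdiff v (pdiffs vs \<psi>) x)"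
    by (rule pdiff_lincomb) (rule smooth_torus_differentiable[OF _ Cons.hyps(2)], rule assms)+
  then show ?case
    unfolding Cons.IH[symmetric] by (simp add: pdiffs_def)
qed

lemma smooth_torus_lincomb:
  assumes "\<phi> \<in> smooth_torus" "\<psi> \<in> smooth_torus"
  shows "(\<lambda>x. a * \<phi> x + b * \<psi> x) \<in> smooth_torus"
proof -
  have "pdiffs vs (\<lambda>x. a * \<phi> x + b * \<psi> x) differentiable_on UNIV" if "vs \<in> lists Basis" for vs
    unfolding pdiffs_lincomb[OF assms that] differentiable_on_def
    using smooth_torus_differentiable[OF assms(1) that] smooth_torus_differentiable[OF assms(2) that]
    by (intro ballI differentiable_add differentiable_mult differentiable_const) blast+
  then show ?thesis
    using assms unfolding smooth_torus_def mem_Collect_eq by simp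
qed

lemma smooth_torus_add:
  "\<lbrakk>\<phi> \<in> smooth_torus; \<psi> \<in> smooth_torus\<rbrakk> \<Longrightarrow> (\<lambda>x. \<phi> x + \<psi> x) \<in> smooth_torus"
  using smooth_torus_lincomb[of \<phi> \<psi> 1 1] by simp

lemma smooth_torus_scale: "\<phi> \<in> smooth_torus \<Longrightarrow> (\<lambda>x. c * \<phi> x) \<in> smooth_torus"
  using smooth_torus_lincomb[of \<phi> \<phi> c 0] by simp

lemma pdiffs_snoc: "pdiffs vs (pdiff v \<phi>) = pdiffs (vs @ [v]) \<phi>"
  by (simp add: pdiffs_def)

lemma frechet_derivative_shift:
  fixes f :: "real \<times> real \<Rightarrow> complex"
  assumes "\<And>x. f (x + p) = f x" "\<And>x. f differentiable (at x)"
  shows "frechet_derivative f (at (x + p)) = frechet_derivative f (at x)"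
proof -
  have "((\<lambda>y. y + p) has_derivative (\<lambda>y. y)) (at x)"
    by (auto intro!: derivative_eq_intros)
  moreover have "(f has_derivative frechet_derivative f (at (x + p))) (at (x + p))"
    using assms(2)[of "x + p"] unfolding frechet_derivative_works .
  ultimately have "((\<lambda>y. f (y + p)) has_derivative frechet_derivative f (at (x + p))) (at x)"
    by (rule has_derivative_compose)
  then have "(f has_derivative frechet_derivative f (at (x + p))) (at x)"
    unfolding assms(1) .
  then show ?thesis by (rule frechet_derivative_at)
qed

lemma smooth_torus_pdiff:
  assumes "\<phi> \<in> smooth_torus" "v \<in> Basis"
  shows "pdiff v \<phi> \<in> smooth_torus"
proof -
  have per: "\<phi> (x + (2 * pi, 0)) = \<phi> x" "\<phi> (x + (0, 2 * pi)) = \<phi> x" for x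
    using assms(1) by (cases x; simp add: smooth_torus_def)+
  have d: "\<phi> differentiable (at x)" for x
    using smooth_torus_differentiable[OF assms(1), of "[]"] by (simp add: pdiffs_def)
  have "pdiff v \<phi> (x + 2 * pi, y) = pdiff v \<phi> (x, y)"
    "pdiff v \<phi> (x, y + 2 * pi) = pdiff v \<phi> (x, y)" for x y
    using frechet_derivative_shift[OF per(1) d, of "(x, y)"]
      frechet_derivative_shift[OF per(2) d, of "(x, y)"]
    by (simp_all add: pdiff_def)
  moreover have "pdiffs vs (pdiff v \<phi>) differentiable_on UNIV" if "vs \<in> lists Basis" for vs
    unfolding pdiffs_snoc differentiable_on_def
    using smooth_torus_differentiable[OF assms(1), of "vs @ [v]"] that assms(2) by simp
  ultimately show ?thesis
    unfolding smooth_torus_def by blast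
qed

lemma basis_plane: "(1, 0) \<in> (Basis :: (real \<times> real) set)" "(0, 1) \<in> (Basis :: (real \<times> real) set)"
  by (simp_all add: Basis_prod_def)

lemma distributions_add:
  "\<lbrakk>u \<in> distributions; \<phi> \<in> smooth_torus; \<psi> \<in> smooth_torus\<rbrakk> \<Longrightarrow> u (\<lambda>x. \<phi> x + \<psi> x) = u \<phi> + u \<psi>"
  unfolding distributions_def by blast

lemma distributions_scale:
  "\<lbrakk>u \<in> distributions; \<phi> \<in> smooth_torus\<rbrakk> \<Longrightarrow> u (\<lambda>x. c * \<phi> x) = c * u \<phi>"
  unfolding distributions_def by blast

lemma distributions_tendsto:
  "\<lbrakk>u \<in> distributions; \<phi> \<in> smooth_torus; \<And>n. F n \<in> smooth_torus; smooth_converges F \<phi>\<rbrakk> \<Longrightarrow>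
    (\<lambda>n. u (F n)) \<longlonglongrightarrow> u \<phi>"
  unfolding distributions_def by blast

lemma distributions_lincomb:
  assumes "u \<in> distributions" "\<phi> \<in> smooth_torus" "\<psi> \<in> smooth_torus"
  shows "u (\<lambda>x. a * \<phi> x + b * \<psi> x) = a * u \<phi> + b * u \<psi>"
  using distributions_add[OF assms(1) smooth_torus_scale[OF assms(2)] smooth_torus_scale[OF assms(3)]]
  unfolding distributions_scale[OF assms(1,2)] distributions_scale[OF assms(1,3)] .

lemma vector_field_apply:
  assumes "u \<in> distributions" "\<phi> \<in> smooth_torus"
  shows "vector_field \<alpha> u \<phi> = u (vector_field_transpose \<alpha> \<phi>)"
proof -
  have "vector_field_transpose \<alpha> \<phi> = (\<lambda>x. (-1) * pdiff (1, 0) \<phi> x + \<alpha> * pdiff (0, 1) \<phi> x)"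
    by (simp add: vector_field_transpose_def fun_eq_iff)
  then show ?thesis
    using distributions_lincomb[OF assms(1) smooth_torus_pdiff[OF assms(2) basis_plane(1)]
      smooth_torus_pdiff[OF assms(2) basis_plane(2)], of "-1" \<alpha>] assms(2)
    by (simp add: vector_field_def dist_deriv_def)
qed

lemma vector_field_transpose_smooth:
  assumes "\<phi> \<in> smooth_torus"
  shows "vector_field_transpose \<alpha> \<phi> \<in> smooth_torus"
proof -
  have "vector_field_transpose \<alpha> \<phi> = (\<lambda>x. (-1) * pdiff (1, 0) \<phi> x + \<alpha> * pdiff (0, 1) \<phi> x)"
    by (simp add: vector_field_transpose_def fun_eq_iff)
  then show ?thesis
    using smooth_torus_lincomb[OF smooth_torus_pdiff[OF assms basis_plane(1)]
      smooth_torus_pdiff[OF assms basis_plane(2)], of "-1" \<alpha>] by argo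
qed

lemma vector_field_transpose_lincomb:
  assumes "\<phi> \<in> smooth_torus" "\<psi> \<in> smooth_torus"
  shows "vector_field_transpose \<alpha> (\<lambda>x. a * \<phi> x + b * \<psi> x) =
    (\<lambda>x. a * vector_field_transpose \<alpha> \<phi> x + b * vector_field_transpose \<alpha> \<psi> x)"
proof -
  have d: "\<phi> differentiable (at x)" "\<psi> differentiable (at x)" for x
    using smooth_torus_differentiable[OF assms(1), of "[]"]
      smooth_torus_differentiable[OF assms(2), of "[]"] by (simp_all add: pdiffs_def)
  show ?thesis
    unfolding vector_field_transpose_def pdiff_lincomb[OF d] by (simp add: algebra_simps fun_eq_iff)
qed

lemma smooth_converges_pdiff:
  "\<lbrakk>smooth_converges F \<phi>; v \<in> Basis\<rbrakk> \<Longrightarrow> smooth_converges (\<lambda>n. pdiff v (F n)) (pdiff v \<phi>)"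
  unfolding smooth_converges_def pdiffs_snoc by simp

lemma vector_field_distributions:
  assumes u: "u \<in> distributions"
  shows "vector_field \<alpha> u \<in> distributions"
proof -
  let ?v = "vector_field \<alpha> u"
  have lin: "?v (\<lambda>x. a * \<phi> x + b * \<psi> x) = a * ?v \<phi> + b * ?v \<psi>"
    if "\<phi> \<in> smooth_torus" "\<psi> \<in> smooth_torus" for \<phi> \<psi> a b
    unfolding vector_field_apply[OF u smooth_torus_lincomb[OF that]]
      vector_field_apply[OF u that(1)] vector_field_apply[OF u that(2)]
      vector_field_transpose_lincomb[OF that]
    by (rule distributions_lincomb[OF u that[THEN vector_field_transpose_smooth]])
  have "?v (\<lambda>x. \<phi> x + \<psi> x) = ?v \<phi> + ?v \<psi>"
    if "\<phi> \<in> smooth_torus" "\<psi> \<in> smooth_torus" for \<phi> \<psi>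
    using lin[OF that, of 1 1] by simp
  moreover have "?v (\<lambda>x. c * \<phi> x) = c * ?v \<phi>" if "\<phi> \<in> smooth_torus" for \<phi> c
    using lin[OF that that, of c 0] by simp
  moreover have "(\<lambda>n. ?v (F n)) \<longlonglongrightarrow> ?v \<phi>"
    if \<phi>: "\<phi> \<in> smooth_torus" and F: "\<And>n. F n \<in> smooth_torus" and conv: "smooth_converges F \<phi>"
    for F \<phi>
  proof -
    have "(\<lambda>n. u (pdiff v (F n))) \<longlonglongrightarrow> u (pdiff v \<phi>)" if "v \<in> Basis" for v
      by (intro distributions_tendsto[OF u] smooth_torus_pdiff \<phi> F that
          smooth_converges_pdiff conv)
    from this[OF basis_plane(1)] this[OF basis_plane(2)]
    have "(\<lambda>n. - u (pdiff (1, 0) (F n)) - \<alpha> * (- u (pdiff (0, 1) (F n))))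
        \<longlonglongrightarrow> - u (pdiff (1, 0) \<phi>) - \<alpha> * (- u (pdiff (0, 1) \<phi>))"
      by (intro tendsto_intros)
    then show ?thesis
      using \<phi> F by (simp add: vector_field_def dist_deriv_def)
  qed
  moreover have "?v \<in> extensional smooth_torus"
    unfolding vector_field_def by (rule restrict_extensional)
  ultimately show ?thesis
    unfolding distributions_def by blast
qed

lemma vector_field_transpose_character:
  "vector_field_transpose \<alpha> (character \<xi>) x =
    \<i> * (of_int (fst (- \<xi>)) - \<alpha> * of_int (snd (- \<xi>))) * character \<xi> x"
  using pdiff_character[of _ 1 \<xi>]
  by (simp add: vector_field_transpose_def algebra_simps)

lemma fourier_vector_field:
  assumes "u \<in> distributions"
  shows "fourier (vector_field \<alpha> u) \<xi> =
    \<i> * (of_int (fst \<xi>) - \<alpha> * of_int (snd \<xi>)) * fourier u \<xi>"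
proof -
  have "u (\<lambda>x. c * character (- \<xi>) x) = c * u (character (- \<xi>))" for c
    using assms character_smooth by (auto simp: distributions_def)
  then show ?thesis
    using vector_field_apply[OF assms character_smooth, of \<alpha> "- \<xi>"]
    by (simp add: fourier_def vector_field_transpose_character[abs_def])
qed

end

theory Submission
  imports Defs
begin

text \<open>
  On Fourier coefficients the vector field is multiplication by the symbol \<open>\<i> (\<xi>\<^sub>1 - \<alpha> \<xi>\<^sub>2)\<close>, and
  distributions on the torus correspond to families of coefficients of polynomial growth. Hence
  both GH-\<open>r\<close> and GS-\<open>r\<close> follow if the nonzero values of the symbol are bounded below by a multiple
  of \<open>\<parallel>\<xi>\<parallel>\<close> to the power \<open>1 - r\<close> (for GH the zero set must also be finite). Conversely, if the symbol is
  smaller than such a power with some \<open>r' > r\<close> at infinitely many frequencies, then coefficients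
  supported on a sparse set of these frequencies violate GH-\<open>r\<close> and, if the symbol does not vanish
  there, GS-\<open>r\<close>. What remains is the size of \<open>\<xi>\<^sub>1 - \<alpha> \<xi>\<^sub>2\<close>: it is elliptic for nonreal \<open>\<alpha>\<close>, takes discrete
  values for rational \<open>\<alpha>\<close>, and is governed by the irrationality measure otherwise.
\<close>

subsection \<open>Fourier coefficients of periodic functions\<close>

text \<open>The loss \<open>r\<close> and the irrationality exponent match because |a - m/n| of size
  |n|^(-mu) means |m - a n| of size |n|^(1 - mu), while \<open>weight\<close> is quadratic in the
  frequency, so that its power (1 - r) / 2 is a power 1 - r of the length. The obstruction argument
  requires a gap r < r', which the infima in the indices do not see. The analytic obstacle is that a
  distribution is given only as a sequentially continuous functional, so the correspondence with
  coefficients has to be won from the smooth functions: fast decay of their coefficients turns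
  polynomially growing families into distributions, and convergence of their Fourier series in the
  smooth topology makes the coefficients determine the distribution. Both rest on 1 minus the
  Laplacian, which multiplies coefficients by \<open>weight\<close>, and on the summability of the
  inverse square of \<open>weight\<close> over the lattice. That a Fourier series converges to the
  right function is a uniqueness statement, obtained from Stone--Weierstrass.\<close>

definition periodic :: "(real \<times> real \<Rightarrow> complex) \<Rightarrow> bool"
  where "periodic f \<longleftrightarrow> (\<forall>x y. f (x + 2 * pi, y) = f (x, y) \<and> f (x, y + 2 * pi) = f (x, y))"

abbreviation square :: "(real \<times> real) set"
  where "square \<equiv> cbox (0, 0) (2 * pi, 2 * pi)"

definition freq :: "int \<times> int \<Rightarrow> real \<times> real \<Rightarrow> real"
  where "freq \<xi> v = of_int (fst \<xi>) * fst v + of_int (snd \<xi>) * snd v"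

definition fourier_coeff :: "(real \<times> real \<Rightarrow> complex) \<Rightarrow> int \<times> int \<Rightarrow> complex"
  where "fourier_coeff f \<xi> = integral square (\<lambda>x. f x * character (- \<xi>) x) / (2 * of_real pi) ^ 2"

lemma character_mult: "character \<xi> x * character \<eta> x = character (\<xi> + \<eta>) x"
  by (simp add: character_def cis_mult algebra_simps)

lemma character_0: "character 0 x = 1"
  by (simp add: character_def)

lemma norm_character [simp]: "norm (character \<xi> x) = 1"
  by (simp add: character_def)

lemma continuous_on_character [continuous_intros]: "continuous_on S (character \<xi>)"
  unfolding character_def by (intro continuous_intros)

lemma periodic_character: "periodic (character \<xi>)"
  using character_smooth unfolding smooth_torus_def periodic_def by blast

lemma periodic_endpoints:
  assumes "periodic f"
  shows "f (2 * pi, y) = f (0, y)" "f (x, 2 * pi) = f (x, 0)"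
proof -
  have "f (0 + 2 * pi, y) = f (0, y)" "f (x, 0 + 2 * pi) = f (x, 0)"
    using assms unfolding periodic_def by blast+
  then show "f (2 * pi, y) = f (0, y)" "f (x, 2 * pi) = f (x, 0)" by simp_all
qed

lemma periodic_mult: "periodic f \<Longrightarrow> periodic g \<Longrightarrow> periodic (\<lambda>x. f x * g x)"
  by (simp add: periodic_def)

lemma smooth_torus_periodic: "\<phi> \<in> smooth_torus \<Longrightarrow> periodic \<phi>"
  unfolding smooth_torus_def periodic_def by blast

lemma smooth_torus_differentiable_at: "\<phi> \<in> smooth_torus \<Longrightarrow> \<phi> differentiable (at x)"
  using smooth_torus_differentiable[of \<phi> "[]"] by (simp add: pdiffs_def)

lemma smooth_torus_continuous: "\<phi> \<in> smooth_torus \<Longrightarrow> continuous_on S \<phi>"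
  by (meson continuous_at_imp_continuous_on differentiable_imp_continuous_within smooth_torus_differentiable_at)

lemma content_square: "measure lborel square = (2 * pi)\<^sup>2"
  by (simp only: content_Pair) (simp add: power2_eq_square)

lemma norm_fourier_coeff_le:
  assumes "continuous_on square f" "\<And>x. x \<in> square \<Longrightarrow> norm (f x) \<le> B"
  shows "norm (fourier_coeff f \<xi>) \<le> B"
proof -
  have "0 \<le> B"
    by (rule order_trans[OF norm_ge_zero assms(2)[of "(0, 0)"]]) (simp add: cbox_Pair_eq)
  then have "norm (integral square (\<lambda>x. f x * character (- \<xi>) x)) \<le> B * measure lborel square"
    by (intro integrable_bound integrable_continuous continuous_intros assms(1))
      (simp_all add: norm_mult assms(2))
  then show ?thesis
    by (simp add: fourier_coeff_def norm_divide norm_power content_square divide_simps)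
qed

lemma fourier_coeff_lincomb:
  assumes "continuous_on square f" "continuous_on square g"
  shows "fourier_coeff (\<lambda>x. a * f x + b * g x) \<xi> = a * fourier_coeff f \<xi> + b * fourier_coeff g \<xi>"
proof -
  have "(\<lambda>x. f x * character (- \<xi>) x) integrable_on square"
       "(\<lambda>x. g x * character (- \<xi>) x) integrable_on square"
    by (intro integrable_continuous continuous_intros assms)+
  then have "integral square (\<lambda>x. a * (f x * character (- \<xi>) x) + b * (g x * character (- \<xi>) x))
     = a * integral square (\<lambda>x. f x * character (- \<xi>) x) + b * integral square (\<lambda>x. g x * character (- \<xi>) x)"
    by (subst integral_add) (auto intro: integrable_on_mult_right)
  then show ?thesis
    by (simp add: fourier_coeff_def algebra_simps add_divide_distrib)
qed

lemma has_derivative_pdiff: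
  "f differentiable (at x) \<Longrightarrow> (f has_derivative (\<lambda>v. pdiff v f x)) (at x)"
  by (simp add: frechet_derivative_works pdiff_def)

text \<open>By Fubini the inner integral can run along the direction of differentiation. There the
  fundamental theorem leaves a difference of values on opposite edges, which periodicity
  cancels.\<close>

lemma integral_pdiff_periodic:
  assumes per: "periodic f" and d: "\<And>x. f differentiable (at x)" and v: "v \<in> Basis"
    and c: "continuous_on square (pdiff v f)"
  shows "integral square (pdiff v f) = 0"
proof -
  have FTC: "integral (cbox 0 (2 * pi)) (\<lambda>t. pdiff w f (p + t *\<^sub>R w)) = f (p + (2 * pi) *\<^sub>R w) - f p" for p w
  proof -
    have "((\<lambda>t. f (p + t *\<^sub>R w)) has_vector_derivative pdiff w f (p + t *\<^sub>R w)) (at t within {0..2 * pi})" for t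
    proof -
      have "((\<lambda>t. p + t *\<^sub>R w) has_derivative (\<lambda>s. s *\<^sub>R w)) (at t within {0..2 * pi})"
        by (auto intro!: derivative_eq_intros)
      then have "((\<lambda>t. f (p + t *\<^sub>R w)) has_derivative (\<lambda>s. pdiff (s *\<^sub>R w) f (p + t *\<^sub>R w)))
          (at t within {0..2 * pi})"
        by (rule has_derivative_compose) (rule has_derivative_pdiff[OF d])
      moreover have "pdiff (s *\<^sub>R w) f (p + t *\<^sub>R w) = s *\<^sub>R pdiff w f (p + t *\<^sub>R w)" for s
        using linear_scale[OF has_derivative_linear[OF has_derivative_pdiff[OF d]]] by simp
      ultimately show ?thesis
        by (simp add: has_vector_derivative_def)
    qed
    from fundamental_theorem_of_calculus[OF _ this] show ?thesis
      by (simp add: integral_unique)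
  qed
  consider "v = (1, 0)" | "v = (0, 1)"
    using v by (auto simp: Basis_prod_def)
  then show ?thesis
  proof cases
    case 1
    \<comment> \<open>The product formula puts the second coordinate innermost; the swap brings the
      first one there.\<close>
    have "integral square (pdiff v f) =
        integral (cbox 0 (2 * pi)) (\<lambda>y. integral (cbox 0 (2 * pi)) (\<lambda>x. pdiff v f (x, y)))"
      using integral_swap_continuous[of 0 0 "2 * pi" "2 * pi" "\<lambda>x y. pdiff v f (x, y)"] c
      by (simp add: integral_prod_continuous[OF c])
    moreover have "integral (cbox 0 (2 * pi)) (\<lambda>x. pdiff v f (x, y)) = 0" for y
      using FTC[of v "(0, y)"] 1 by (simp add: periodic_endpoints[OF per])
    ultimately show ?thesis by simp
  next
    case 2
    have "integral (cbox 0 (2 * pi)) (\<lambda>y. pdiff v f (x, y)) = 0" for x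
      using FTC[of v "(x, 0)"] 2 by (simp add: periodic_endpoints[OF per])
    then show ?thesis
      by (simp add: integral_prod_continuous[OF c])
  qed
qed

lemma pdiff_mult_character:
  assumes "f differentiable (at x)"
  shows "(\<lambda>x. f x * character \<eta> x) differentiable (at x)"
    "pdiff v (\<lambda>x. f x * character \<eta> x) x =
      pdiff v f x * character \<eta> x + \<i> * of_real (freq \<eta> v) * (f x * character \<eta> x)"
proof -
  have *: "((\<lambda>x. f x * character \<eta> x) has_derivative
      (\<lambda>v. pdiff v f x * character \<eta> x + \<i> * of_real (freq \<eta> v) * (f x * character \<eta> x))) (at x)"
    using has_derivative_mult[OF has_derivative_pdiff[OF assms]
        character_has_derivative[of 1 \<eta>, simplified mult_1_left]]
    by (simp add: freq_def algebra_simps)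
  then show "(\<lambda>x. f x * character \<eta> x) differentiable (at x)"
    by (auto simp: differentiable_def)
  show "pdiff v (\<lambda>x. f x * character \<eta> x) x =
      pdiff v f x * character \<eta> x + \<i> * of_real (freq \<eta> v) * (f x * character \<eta> x)"
    unfolding pdiff_def frechet_derivative_at[OF *, symmetric] ..
qed

text \<open>Integration by parts: the derivative of \<open>f\<close> times the opposite character
  integrates to zero, and the term with \<open>freq (- \<xi>) v\<close> from the product rule
  changes sign when moved to the other side.\<close>

lemma fourier_coeff_pdiff:
  assumes per: "periodic f" and d: "\<And>x. f differentiable (at x)" and v: "v \<in> Basis"
    and c: "continuous_on square (pdiff v f)"
  shows "fourier_coeff (pdiff v f) \<xi> = \<i> * of_real (freq \<xi> v) * fourier_coeff f \<xi>"
proof -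
  let ?g = "\<lambda>x. f x * character (- \<xi>) x"
  have pd: "pdiff v ?g = (\<lambda>x. pdiff v f x * character (- \<xi>) x + \<i> * of_real (freq (- \<xi>) v) * ?g x)"
    by (rule ext) (rule pdiff_mult_character(2)[OF d])
  have cf: "continuous_on square f"
    by (meson continuous_at_imp_continuous_on differentiable_imp_continuous_within d)
  have "integral square (pdiff v ?g) = 0"
    by (intro integral_pdiff_periodic periodic_mult per periodic_character pdiff_mult_character(1) d v)
      (unfold pd, intro continuous_intros c cf)
  moreover have "(\<lambda>x. pdiff v f x * character (- \<xi>) x) integrable_on square" "?g integrable_on square"
    by (intro integrable_continuous continuous_intros c cf)+
  ultimately have "integral square (\<lambda>x. pdiff v f x * character (- \<xi>) x)
      + \<i> * of_real (freq (- \<xi>) v) * integral square ?g = 0"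
    unfolding pd by (subst (asm) integral_add) (auto intro: integrable_on_mult_right)
  then have "integral square (\<lambda>x. pdiff v f x * character (- \<xi>) x)
      = \<i> * of_real (freq \<xi> v) * integral square ?g"
    by (simp add: freq_def algebra_simps add_eq_0_iff)
  then show ?thesis
    by (simp add: fourier_coeff_def)
qed

lemma fourier_coeff_pdiff_smooth:
  assumes "\<phi> \<in> smooth_torus" "v \<in> Basis"
  shows "fourier_coeff (pdiff v \<phi>) \<xi> = \<i> * of_real (freq \<xi> v) * fourier_coeff \<phi> \<xi>"
  by (intro fourier_coeff_pdiff smooth_torus_periodic smooth_torus_differentiable_at
      smooth_torus_continuous smooth_torus_pdiff assms)

text \<open>For a nonzero frequency some coordinate derivative of the character is a nonzero
  multiple of the character, and derivatives of periodic functions integrate to zero.\<close>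

lemma integral_character: "integral square (character \<xi>) = (if \<xi> = 0 then (2 * of_real pi)\<^sup>2 else 0)"
proof (cases "\<xi> = 0")
  case True
  then have "character \<xi> = (\<lambda>x. 1)"
    by (simp add: character_0 fun_eq_iff)
  then show ?thesis
    using True by (simp add: content_square scaleR_conv_of_real)
next
  case False
  then obtain v where v: "v \<in> Basis" "freq \<xi> v \<noteq> 0"
    using basis_plane by (cases \<xi>) (force simp: freq_def zero_prod_def)
  have pd: "pdiff v (character \<xi>) = (\<lambda>x. \<i> * of_real (freq \<xi> v) * character \<xi> x)"
    using pdiff_character[of v 1 \<xi>] by (simp add: freq_def)
  have "integral square (pdiff v (character \<xi>)) = 0"
    by (intro integral_pdiff_periodic periodic_character smooth_torus_differentiable_at
        smooth_torus_continuous smooth_torus_pdiff character_smooth v(1))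
  then show ?thesis
    using v(2) False by (simp add: pd)
qed

lemma fourier_coeff_character: "fourier_coeff (character \<xi>) \<eta> = (if \<xi> = \<eta> then 1 else 0)"
  using integral_character[of "\<xi> - \<eta>"] by (simp add: fourier_coeff_def character_mult)

section \<open>Trigonometric polynomials: density and uniqueness of Fourier coefficients\<close>

inductive trig_poly :: "(real \<times> real \<Rightarrow> complex) \<Rightarrow> bool" where
  character: "trig_poly (\<lambda>x. c * character \<xi> x)"
| add: "trig_poly f \<Longrightarrow> trig_poly g \<Longrightarrow> trig_poly (\<lambda>x. f x + g x)"

lemma trig_poly_continuous: "trig_poly f \<Longrightarrow> continuous_on S f"
  by (induction rule: trig_poly.induct) (intro continuous_intros | assumption)+

lemma trig_poly_mult:
  assumes "trig_poly f" "trig_poly g"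
  shows "trig_poly (\<lambda>x. f x * g x)"
  using assms(1)
proof induction
  case (character c \<xi>)
  show ?case using assms(2)
  proof induction
    case (character d \<eta>)
    have "(\<lambda>x. c * character \<xi> x * (d * character \<eta> x)) = (\<lambda>x. (c * d) * character (\<xi> + \<eta>) x)"
      by (simp add: character_mult[symmetric] fun_eq_iff)
    then show ?case by (simp only: trig_poly.character)
  next
    case (add f g)
    then show ?case by (simp only: distrib_left trig_poly.add)
  qed
next
  case (add f g)
  then show ?case by (simp only: distrib_right trig_poly.add)
qed

lemma trig_poly_const: "trig_poly (\<lambda>x. c)"
  using trig_poly.character[of c 0] by (simp add: character_0)

lemma trig_poly_cis:
  "trig_poly (\<lambda>x. complex_of_real (Re (a * cis (fst x))))"
  "trig_poly (\<lambda>x. complex_of_real (Re (a * cis (snd x))))"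
proof -
  have *: "trig_poly (\<lambda>x. a / 2 * character \<xi> x + cnj a / 2 * character (- \<xi>) x)" for \<xi>
    by (intro trig_poly.intros)
  have **: "complex_of_real (Re (a * cis t)) = a / 2 * cis t + cnj a / 2 * cis (- t)" for t
    by (simp add: complex_eq_iff field_simps)
  show "trig_poly (\<lambda>x. complex_of_real (Re (a * cis (fst x))))"
    unfolding ** using *[of "(1, 0)"] by (simp add: character_def)
  show "trig_poly (\<lambda>x. complex_of_real (Re (a * cis (snd x))))"
    unfolding ** using *[of "(0, 1)"] by (simp add: character_def)
qed

definition torus_embedding :: "real \<times> real \<Rightarrow> complex \<times> complex"
  where "torus_embedding x = (cis (fst x), cis (snd x))"

text \<open>Stone--Weierstrass supplies polynomials in real linear functionals, so those on one
  complex coordinate have to be recognised. The multiplier has real part \<open>f 1\<close> and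
  imaginary part \<open>- f \<i>\<close>.\<close>

lemma real_linear_complex:
  assumes "bounded_linear (f :: complex \<Rightarrow> real)"
  obtains a where "\<And>z. f z = Re (a * z)"
proof
  interpret bounded_linear f by fact
  fix z :: complex
  have "z = Re z *\<^sub>R 1 + Im z *\<^sub>R \<i>"
    by (simp add: complex_eq_iff)
  then have "f z = f (Re z *\<^sub>R 1 + Im z *\<^sub>R \<i>)"
    by (rule arg_cong)
  also have "\<dots> = Re z * f 1 + Im z * f \<i>"
    by (simp add: add scaleR)
  finally show "f z = Re (Complex (f 1) (- f \<i>) * z)"
    by (simp add: algebra_simps)
qed

text \<open>A linear functional splits over the two coordinates into real parts of multiples of
  \<open>cis\<close>, each the sum of multiples of a character and its opposite. Sums and products
  follow from the closure of \<open>trig_poly\<close>.\<close>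

lemma real_polynomial_torus_embedding:
  assumes "real_polynomial_function p"
  shows "trig_poly (\<lambda>x. complex_of_real (p (torus_embedding x)))"
  using assms
proof induction
  case (linear f)
  note f = linear
  interpret bounded_linear f by fact
  have "bounded_linear (\<lambda>z. f (z, 0))" "bounded_linear (\<lambda>z. f (0, z))"
    by (rule bounded_linear_compose[OF f],
      intro bounded_linear_Pair bounded_linear_ident bounded_linear_zero)+
  then obtain a b where ab: "\<And>z. f (z, 0) = Re (a * z)" "\<And>z. f (0, z) = Re (b * z)"
    by (metis real_linear_complex)
  have "f (torus_embedding x) = Re (a * cis (fst x)) + Re (b * cis (snd x))" for x
    using add[of "(cis (fst x), 0)" "(0, cis (snd x))"] ab by (simp add: torus_embedding_def)
  then show ?case
    by (simp only: of_real_add) (intro trig_poly.add trig_poly_cis)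
qed (simp_all only: of_real_add of_real_mult trig_poly.add trig_poly_mult trig_poly_const)

lemma polynomial_torus_embedding:
  assumes "polynomial_function (p :: complex \<times> complex \<Rightarrow> complex)"
  shows "trig_poly (\<lambda>x. p (torus_embedding x))"
proof -
  have "real_polynomial_function (Re \<circ> p)" "real_polynomial_function (Im \<circ> p)"
    using assms bounded_linear_Re bounded_linear_Im unfolding polynomial_function_def by blast+
  from this[THEN real_polynomial_torus_embedding]
  have "trig_poly (\<lambda>x. complex_of_real ((Re \<circ> p) (torus_embedding x))
      + \<i> * complex_of_real ((Im \<circ> p) (torus_embedding x)))"
    by (intro trig_poly.add trig_poly_mult trig_poly_const)
  then show ?thesis
    by (simp add: complex_eq[symmetric])
qed

text \<open>The square is closed for the sake of compactness, so \<open>torus_embedding\<close> is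
  not injective on it. Only points on opposite edges are identified, and there periodic functions
  agree.\<close>

lemma cis_eq_imp_endpoints:
  assumes "cis s = cis t" "0 \<le> s" "s \<le> 2 * pi" "0 \<le> t" "t \<le> 2 * pi"
  shows "s = t \<or> s = 0 \<and> t = 2 * pi \<or> s = 2 * pi \<and> t = 0"
proof -
  have "sin s = sin t \<and> cos s = cos t"
    using assms(1) by (simp add: complex_eq_iff)
  then obtain n where n: "s = t + 2 * pi * of_int n"
    using sin_cos_eq_iff[of s t] by auto
  have "2 * pi * of_int n \<le> 2 * pi * 1" "2 * pi * (-1) \<le> 2 * pi * of_int n"
    using n assms(2-) by linarith+
  then have "real_of_int n \<le> 1" "-1 \<le> real_of_int n"
    by (simp_all only: mult_le_cancel_left_pos[of "2 * pi"] pi_gt_zero mult_pos_pos zero_less_numeral)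
  then have "n \<le> 1" "-1 \<le> n"
    by linarith+
  then have "n = 0 \<or> n = 1 \<or> n = -1" by linarith
  then show ?thesis
    using n assms(2-) by auto
qed

text \<open>
  A periodic function descends to the image of the plane in \<open>\<complex>\<^sup>2\<close>, where Stone--Weierstrass applies.
\<close>

lemma trig_poly_dense:
  assumes per: "periodic f" and cont: "continuous_on square f" and e: "0 < e"
  obtains p where "trig_poly p" "\<And>x. x \<in> square \<Longrightarrow> norm (f x - p x) < e"
proof -
  let ?T = "torus_embedding ` square"
  have cE: "continuous_on square torus_embedding"
    unfolding torus_embedding_def by (intro continuous_intros)
  have wd: "f x = f y" if x: "x \<in> square" and y: "y \<in> square" and eq: "torus_embedding x = torus_embedding y" for x y
  proof -
    note P = periodic_endpoints[OF per]
    obtain x1 x2 y1 y2 where xy: "x = (x1, x2)" "y = (y1, y2)" by (cases x, cases y)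
    have "x1 = y1 \<or> x1 = 0 \<and> y1 = 2 * pi \<or> x1 = 2 * pi \<and> y1 = 0"
      "x2 = y2 \<or> x2 = 0 \<and> y2 = 2 * pi \<or> x2 = 2 * pi \<and> y2 = 0"
      by (rule cis_eq_imp_endpoints; use x y eq in \<open>simp add: xy cbox_Pair_eq torus_embedding_def\<close>)+
    then show ?thesis
      unfolding xy by (elim disjE conjE) (simp_all add: P)
  qed
  \<comment> \<open>A continuous map from a compact space to a Hausdorff space is closed, hence a
    quotient map onto its image. This makes the descended function \<open>g\<close>
    continuous.\<close>
  have "quotient_map (top_of_set square) (top_of_set ?T) torus_embedding"
  proof (rule continuous_closed_imp_quotient_map)
    show "continuous_map (top_of_set square) (top_of_set ?T) torus_embedding"
      using cE by auto
    show "closed_map (top_of_set square) (top_of_set ?T) torus_embedding"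
    proof (rule continuous_imp_closed_map)
      show "compact_space (top_of_set square)"
        by (simp add: compact_space_subtopology)
      show "Hausdorff_space (top_of_set ?T)"
        by (rule Hausdorff_space_subtopology) simp
      show "continuous_map (top_of_set square) (top_of_set ?T) torus_embedding"
        using cE by simp
    qed
  qed auto
  then obtain g where g: "continuous_map (top_of_set ?T) euclidean g"
      "\<And>x. x \<in> topspace (top_of_set square) \<Longrightarrow> g (torus_embedding x) = f x"
  proof (rule quotient_map_lift_exists)
    show "continuous_map (top_of_set square) euclidean f"
      using cont by simp
    show "f x = f y" if "x \<in> topspace (top_of_set square)" "y \<in> topspace (top_of_set square)"
      "torus_embedding x = torus_embedding y" for x y
      by (rule wd) (use that in simp_all)
  qed blast
  have "compact ?T" "continuous_on ?T g"
    using compact_continuous_image[OF cE compact_cbox] g(1) by simp_all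
  from Stone_Weierstrass_polynomial_function[OF this e] obtain q where
    q: "polynomial_function q" "\<forall>x\<in>?T. norm (g x - q x) < e" by blast
  show thesis
    by (rule that[of "\<lambda>x. q (torus_embedding x)"])
      (use q(2) g(2) polynomial_torus_embedding[OF q(1)] in force)+
qed

text \<open>Vanishing coefficients make \<open>f\<close> orthogonal to every trigonometric
  polynomial \<open>p\<close>. Choosing \<open>p\<close> close to \<open>cnj (f x)\<close>, the
  integral of the squared modulus equals that of \<open>f\<close> times the error and is therefore
  arbitrarily small. Continuity turns a zero integral into a zero function.\<close>

lemma fourier_coeff_unique_zero:
  assumes per: "periodic f" and cont: "continuous_on square f" and z: "\<And>\<xi>. fourier_coeff f \<xi> = 0"
    and x: "x \<in> square"
  shows "f x = 0"
proof -
  have orth: "integral square (\<lambda>x. f x * p x) = 0" if "trig_poly p" for p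
    using that
  proof induction
    case (character c \<xi>)
    have "integral square (\<lambda>x. f x * character \<xi> x) = 0"
      using z[of "- \<xi>"] by (simp add: fourier_coeff_def)
    then show ?case
      using integral_mult_right[of square c "\<lambda>x. f x * character \<xi> x"] by (simp add: mult_ac)
  next
    case (add p q)
    have "(\<lambda>x. f x * p x) integrable_on square" "(\<lambda>x. f x * q x) integrable_on square"
      by (intro integrable_continuous continuous_intros cont trig_poly_continuous add)+
    then show ?case
      using add by (simp add: distrib_left integral_add)
  qed
  obtain B where B: "0 < B" "\<And>x. x \<in> square \<Longrightarrow> norm (f x) \<le> B"
    using compact_imp_bounded[OF compact_continuous_image[OF cont compact_cbox]]
    unfolding bounded_pos by blast
  define I where "I = integral square (\<lambda>x. (norm (f x))\<^sup>2)"
  have small: "I \<le> B * e * measure lborel square" if e: "0 < e" for e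
  proof -
    obtain p where p: "trig_poly p" "\<And>x. x \<in> square \<Longrightarrow> norm (cnj (f x) - p x) < e"
      using trig_poly_dense[of "\<lambda>x. cnj (f x)" e] per cont e
      by (auto simp: periodic_def intro: continuous_intros)
    have cnjf: "f x * cnj (f x) = of_real ((norm (f x))\<^sup>2)" for x
      by (rule complex_norm_square[symmetric])
    have "(\<lambda>x. f x * cnj (f x)) integrable_on square" "(\<lambda>x. f x * p x) integrable_on square"
      by (intro integrable_continuous continuous_intros cont trig_poly_continuous p)+
    then have "integral square (\<lambda>x. f x * (cnj (f x) - p x)) = integral square (\<lambda>x. f x * cnj (f x))"
      by (simp add: right_diff_distrib integral_diff orth[OF p(1)])
    also have "\<dots> = of_real I"
      unfolding cnjf I_def
      by (rule integral_unique, rule has_integral_of_real, rule integrable_integral)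
        (intro integrable_continuous continuous_intros cont)
    finally have "norm (of_real I :: complex) = norm (integral square (\<lambda>x. f x * (cnj (f x) - p x)))" 
      by simp
    also have "\<dots> \<le> B * e * measure lborel square"
    proof (rule integrable_bound)
      show "(\<lambda>x. f x * (cnj (f x) - p x)) integrable_on square"
        by (intro integrable_continuous continuous_intros cont trig_poly_continuous p)
      show "norm (f x * (cnj (f x) - p x)) \<le> B * e" if "x \<in> square" for x
        unfolding norm_mult using B(1) by (intro mult_mono B(2) less_imp_le[OF p(2)] that) auto
    qed (use B(1) e in simp)
    finally show ?thesis by simp
  qed
  have "I \<le> 0"
  proof (rule field_le_epsilon)
    fix e :: real assume "0 < e"
    then show "I \<le> 0 + e"
      using small[of "e / (B * measure lborel square)"] B(1) by (simp add: content_square)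
  qed
  moreover have "0 \<le> I"
    unfolding I_def by (intro integral_nonneg integrable_continuous continuous_intros cont) auto
  ultimately have "integral square (\<lambda>x. (norm (f x))\<^sup>2) = 0"
    unfolding I_def by simp
  moreover have "box (0, 0) (2 * pi, 2 * pi) \<noteq> {}"
    by (auto simp: box_ne_empty Basis_prod_def)
  ultimately have "\<forall>x\<in>square. (norm (f x))\<^sup>2 = 0"
    using integral_cbox_eq_0_iff[of "(0, 0)" "(2 * pi, 2 * pi)" "\<lambda>x. (norm (f x))\<^sup>2"]
    by (simp add: continuous_intros cont)
  then show ?thesis using x by simp
qed

subsection \<open>Fourier series of smooth functions and distributions\<close>

definition weight :: "int \<times> int \<Rightarrow> real"
  where "weight \<xi> = 1 + ((of_int (fst \<xi>))\<^sup>2 + (of_int (snd \<xi>))\<^sup>2)"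

lemma weight_ge_1: "1 \<le> weight \<xi>"
  by (simp add: weight_def)

lemma weight_pos: "0 < weight \<xi>"
  using weight_ge_1[of \<xi>] by linarith

lemma weight_minus [simp]: "weight (- \<xi>) = weight \<xi>"
  by (simp add: weight_def)

lemma summable_on_inverse_int_square: "(\<lambda>n::int. 1 / (1 + (of_int n)\<^sup>2) :: real) summable_on UNIV"
proof -
  have "summable (\<lambda>n. norm (1 / (1 + (real n)\<^sup>2)))"
    by (rule summable_comparison_test'[OF inverse_power_summable[of 2, unfolded inverse_eq_divide], of 1])
      (auto simp: frac_le)
  then have nat: "(\<lambda>n. 1 / (1 + (real n)\<^sup>2)) summable_on UNIV"
    by (rule norm_summable_imp_summable_on)
  have "(\<lambda>n::int. 1 / (1 + (of_int n)\<^sup>2) :: real) summable_on range int"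
    using nat by (subst summable_on_reindex) (auto simp: o_def inj_on_def)
  moreover have "(\<lambda>n::int. 1 / (1 + (of_int n)\<^sup>2) :: real) summable_on range (\<lambda>n. - int n)"
    using nat by (subst summable_on_reindex) (auto simp: o_def inj_on_def)
  then have "(\<lambda>n::int. 1 / (1 + (of_int n)\<^sup>2) :: real) summable_on (range (\<lambda>n. - int n) - range int)"
    by (rule summable_on_subset_banach) auto
  ultimately have "(\<lambda>n::int. 1 / (1 + (of_int n)\<^sup>2) :: real) summable_on
      (range int \<union> (range (\<lambda>n. - int n) - range int))"
    by (rule summable_on_Un_disjoint) auto
  moreover have "range int \<union> (range (\<lambda>n. - int n) - range int) = UNIV"
    by (auto simp: image_iff) (metis int_cases2)
  ultimately show ?thesis by simp
qed

text \<open>The square of \<open>weight\<close> dominates the product of the two one-dimensional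
  weights, so a product of two convergent series bounds the lattice sum. With the first power of
  \<open>weight\<close> the sum would diverge logarithmically.\<close>

lemma summable_on_inverse_weight_square: "(\<lambda>\<xi>. 1 / (weight \<xi>)\<^sup>2) summable_on UNIV"
proof -
  let ?h = "\<lambda>n::int. 1 / (1 + (of_int n)\<^sup>2) :: real"
  have "(\<lambda>(a, b). ?h a * ?h b) summable_on (UNIV \<times> UNIV)"
  proof (rule summable_on_SigmaI)
    show "((\<lambda>b. case (a, b) of (a, b) \<Rightarrow> ?h a * ?h b) has_sum ?h a * infsum ?h UNIV) UNIV" for a
      using has_sum_cmult_right[OF has_sum_infsum[OF summable_on_inverse_int_square], of "?h a"] by simp
    show "(\<lambda>a. ?h a * infsum ?h UNIV) summable_on UNIV"
      by (intro summable_on_cmult_left summable_on_inverse_int_square)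
  qed simp
  then have "(\<lambda>(a, b). ?h a * ?h b) summable_on UNIV" by simp
  then show ?thesis
  proof (rule summable_on_comparison_test)
    show "1 / (weight \<xi>)\<^sup>2 \<le> (case \<xi> of (a, b) \<Rightarrow> ?h a * ?h b)" for \<xi>
    proof -
      obtain a b where \<xi>: "\<xi> = (a, b)" by (cases \<xi>)
      have "(1 + (real_of_int a)\<^sup>2) * (1 + (real_of_int b)\<^sup>2) \<le> weight \<xi> * weight \<xi>"
        by (intro mult_mono) (auto simp: weight_def \<xi>)
      then have "1 / (weight \<xi> * weight \<xi>) \<le> 1 / ((1 + (real_of_int a)\<^sup>2) * (1 + (real_of_int b)\<^sup>2))"
        by (intro divide_left_mono mult_pos_pos weight_pos) (auto simp: add_pos_nonneg)
      then show ?thesis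
        by (simp add: \<xi> power2_eq_square)
    qed
  qed simp
qed

text \<open>The operator 1 minus the Laplacian, whose Fourier multiplier is \<open>weight\<close>.
  One operator thus measures smoothness in both variables.\<close>

definition bessel :: "(real \<times> real \<Rightarrow> complex) \<Rightarrow> real \<times> real \<Rightarrow> complex"
  where "bessel \<phi> x = \<phi> x - (pdiff (1, 0) (pdiff (1, 0) \<phi>) x + pdiff (0, 1) (pdiff (0, 1) \<phi>) x)"

text \<open>The explicit scalars 1 and -1 give the form to which the rules for linear combinations
  apply.\<close>

lemma bessel_eq_lincomb:
  "bessel \<phi> = (\<lambda>x. 1 * \<phi> x + (-1) * (1 * pdiff (1, 0) (pdiff (1, 0) \<phi>) x + 1 * pdiff (0, 1) (pdiff (0, 1) \<phi>) x))"
  by (simp add: bessel_def fun_eq_iff)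

lemma bessel_smooth: "\<phi> \<in> smooth_torus \<Longrightarrow> bessel \<phi> \<in> smooth_torus"
  unfolding bessel_eq_lincomb
  by (intro smooth_torus_lincomb smooth_torus_pdiff basis_plane)

lemma fourier_coeff_bessel:
  assumes "\<phi> \<in> smooth_torus"
  shows "fourier_coeff (bessel \<phi>) \<xi> = of_real (weight \<xi>) * fourier_coeff \<phi> \<xi>"
proof -
  note smooth = smooth_torus_pdiff[OF smooth_torus_pdiff[OF assms]] smooth_torus_pdiff[OF assms] basis_plane
  show ?thesis
    unfolding bessel_eq_lincomb
    by (simp only: fourier_coeff_lincomb smooth_torus_continuous smooth_torus_lincomb smooth
        fourier_coeff_pdiff_smooth assms)
      (simp add: freq_def weight_def algebra_simps power2_eq_square)
qed

text \<open>\<open>pdiffs\<close> applies the last letter of a word first, so the second derivatives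
  inside \<open>bessel\<close> are appended at the end of \<open>vs\<close>.\<close>

lemma pdiffs_bessel:
  assumes "\<phi> \<in> smooth_torus" "vs \<in> lists Basis"
  shows "pdiffs vs (bessel \<phi>) = (\<lambda>x. pdiffs vs \<phi> x -
    (pdiffs (vs @ [(1, 0), (1, 0)]) \<phi> x + pdiffs (vs @ [(0, 1), (0, 1)]) \<phi> x))"
proof -
  note smooth = smooth_torus_pdiff[OF smooth_torus_pdiff[OF assms(1)]] basis_plane
  show ?thesis
    unfolding bessel_eq_lincomb
    by (simp only: pdiffs_lincomb smooth_torus_lincomb smooth assms)
      (simp add: pdiffs_def fun_eq_iff)
qed

lemma smooth_converges_bessel:
  assumes "smooth_converges F \<phi>" "\<And>n. F n \<in> smooth_torus" "\<phi> \<in> smooth_torus"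
  shows "smooth_converges (\<lambda>n. bessel (F n)) (bessel \<phi>)"
  unfolding smooth_converges_def
proof
  fix vs :: "(real \<times> real) list"
  assume vs: "vs \<in> lists Basis"
  have lim: "uniform_limit UNIV (\<lambda>n. pdiffs (vs @ ws) (F n)) (pdiffs (vs @ ws) \<phi>) sequentially"
    if "ws \<in> lists Basis" for ws
    using assms(1) vs that unfolding smooth_converges_def by simp
  show "uniform_limit UNIV (\<lambda>n. pdiffs vs (bessel (F n))) (pdiffs vs (bessel \<phi>)) sequentially"
    unfolding pdiffs_bessel[OF assms(2) vs] pdiffs_bessel[OF assms(3) vs]
    using lim[of "[]"] lim[of "[(1, 0), (1, 0)]"] lim[of "[(0, 1), (0, 1)]"] basis_plane
    by (intro uniform_limit_minus uniform_limit_add) simp_all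
qed

lemma bessel_funpow_smooth: "\<phi> \<in> smooth_torus \<Longrightarrow> (bessel ^^ N) \<phi> \<in> smooth_torus"
  by (induction N) (auto intro: bessel_smooth)

lemma fourier_coeff_bessel_funpow:
  "\<phi> \<in> smooth_torus \<Longrightarrow> fourier_coeff ((bessel ^^ N) \<phi>) \<xi> = of_real (weight \<xi> ^ N) * fourier_coeff \<phi> \<xi>"
  by (induction N) (simp_all add: fourier_coeff_bessel bessel_funpow_smooth mult_ac)

lemma smooth_converges_bessel_funpow:
  assumes "smooth_converges F \<phi>" "\<And>n. F n \<in> smooth_torus" "\<phi> \<in> smooth_torus"
  shows "smooth_converges (\<lambda>n. (bessel ^^ N) (F n)) ((bessel ^^ N) \<phi>)"
  by (induction N) (simp_all add: assms smooth_converges_bessel bessel_funpow_smooth)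

lemma bessel_lincomb:
  assumes "\<phi> \<in> smooth_torus" "\<psi> \<in> smooth_torus"
  shows "bessel (\<lambda>x. a * \<phi> x + b * \<psi> x) = (\<lambda>x. a * bessel \<phi> x + b * bessel \<psi> x)"
proof -
  have *: "pdiff v (\<lambda>x. a * \<phi> x + b * \<psi> x) = (\<lambda>x. a * pdiff v \<phi> x + b * pdiff v \<psi> x)"
    if "\<phi> \<in> smooth_torus" "\<psi> \<in> smooth_torus" for v \<phi> \<psi>
    by (rule pdiff_lincomb) (intro smooth_torus_differentiable_at that)+
  show ?thesis
    unfolding bessel_def
    by (simp add: * assms smooth_torus_pdiff basis_plane algebra_simps)
qed

lemma bessel_funpow_lincomb:
  assumes "\<phi> \<in> smooth_torus" "\<psi> \<in> smooth_torus"
  shows "(bessel ^^ N) (\<lambda>x. a * \<phi> x + b * \<psi> x) = (\<lambda>x. a * (bessel ^^ N) \<phi> x + b * (bessel ^^ N) \<psi> x)"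
  by (induction N) (simp_all add: bessel_lincomb bessel_funpow_smooth assms)

text \<open>A coefficient is bounded by the supremum of the function; applied to the
  \<open>N\<close>-th iterate of \<open>bessel\<close>, this gains the factor
  \<open>weight \<xi> ^ N\<close>.\<close>

lemma fourier_coeff_decay:
  assumes "\<phi> \<in> smooth_torus" "\<And>x. x \<in> square \<Longrightarrow> norm ((bessel ^^ N) \<phi> x) \<le> B"
  shows "norm (fourier_coeff \<phi> \<xi>) \<le> B / weight \<xi> ^ N"
proof -
  have "weight \<xi> ^ N * norm (fourier_coeff \<phi> \<xi>) = norm (fourier_coeff ((bessel ^^ N) \<phi>) \<xi>)"
    using weight_pos[of \<xi>]
    by (simp add: fourier_coeff_bessel_funpow[OF assms(1)] norm_mult norm_power)
  also have "\<dots> \<le> B"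
    by (intro norm_fourier_coeff_le smooth_torus_continuous bessel_funpow_smooth assms)
  finally show ?thesis
    using weight_pos[of \<xi>] by (simp add: pos_le_divide_eq mult.commute)
qed

section \<open>Distributions with prescribed Fourier coefficients\<close>

lemma smooth_torus_bounded:
  assumes "\<phi> \<in> smooth_torus"
  obtains B where "0 < B" "\<And>x. x \<in> square \<Longrightarrow> norm (\<phi> x) \<le> B"
  using compact_imp_bounded[OF compact_continuous_image[OF smooth_torus_continuous[OF assms] compact_cbox]]
  unfolding bounded_pos by blast

text \<open>The frequency is negated because \<^const>\<open>fourier\<close> evaluates at the character of opposite frequency.\<close>

definition of_coeffs :: "(int \<times> int \<Rightarrow> complex) \<Rightarrow> functional"
  where "of_coeffs a = (\<lambda>\<phi>\<in>smooth_torus. (2 * of_real pi) ^ 2 * (\<Sum>\<^sub>\<infinity>\<xi>. a \<xi> * fourier_coeff \<phi> (- \<xi>)))"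

text \<open>Of the M + 2 powers of decay, M absorb the growth of \<open>a\<close> and two make the
  series converge. The bound is linear in \<open>B\<close>, so applying it to differences of test
  functions yields continuity.\<close>

lemma of_coeffs_estimate:
  assumes a: "\<And>\<xi>. norm (a \<xi>) \<le> C * weight \<xi> ^ M" and \<phi>: "\<phi> \<in> smooth_torus"
    and B: "\<And>x. x \<in> square \<Longrightarrow> norm ((bessel ^^ (M + 2)) \<phi> x) \<le> B"
  shows "(\<lambda>\<xi>. a \<xi> * fourier_coeff \<phi> (- \<xi>)) summable_on UNIV"
    "norm (of_coeffs a \<phi>) \<le> (2 * pi) ^ 2 * (C * B * (\<Sum>\<^sub>\<infinity>\<xi>. 1 / (weight \<xi>)\<^sup>2))"
proof -
  have le: "norm (a \<xi> * fourier_coeff \<phi> (- \<xi>)) \<le> C * B * (1 / (weight \<xi>)\<^sup>2)" for \<xi>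
  proof -
    have "norm (a \<xi> * fourier_coeff \<phi> (- \<xi>)) \<le> (C * weight \<xi> ^ M) * (B / weight \<xi> ^ (M + 2))"
      unfolding norm_mult using fourier_coeff_decay[OF \<phi> B, of "- \<xi>"]
      by (intro mult_mono a) (auto intro: order_trans[OF norm_ge_zero a])
    also have "\<dots> = C * B * (1 / (weight \<xi>)\<^sup>2)"
      using weight_pos[of \<xi>] by (simp add: power_add power2_eq_square)
    finally show ?thesis .
  qed
  have s: "(\<lambda>\<xi>. C * B * (1 / (weight \<xi>)\<^sup>2)) summable_on UNIV"
    by (intro summable_on_cmult_right summable_on_inverse_weight_square)
  show sum: "(\<lambda>\<xi>. a \<xi> * fourier_coeff \<phi> (- \<xi>)) summable_on UNIV"
    by (rule abs_summable_summable, rule Infinite_Sum.abs_summable_on_comparison_test'[OF s]) (rule le)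
  have "norm (\<Sum>\<^sub>\<infinity>\<xi>. a \<xi> * fourier_coeff \<phi> (- \<xi>)) \<le> C * B * (\<Sum>\<^sub>\<infinity>\<xi>. 1 / (weight \<xi>)\<^sup>2)"
    by (rule norm_infsum_le[OF has_sum_infsum[OF sum]
          has_sum_cmult_right[OF has_sum_infsum[OF summable_on_inverse_weight_square]] le])
  then show "norm (of_coeffs a \<phi>) \<le> (2 * pi) ^ 2 * (C * B * (\<Sum>\<^sub>\<infinity>\<xi>. 1 / (weight \<xi>)\<^sup>2))"
    using \<phi> by (simp add: of_coeffs_def norm_mult norm_power mult_left_mono)
qed

lemma of_coeffs_lincomb:
  assumes a: "\<And>\<xi>. norm (a \<xi>) \<le> C * weight \<xi> ^ M" and \<phi>: "\<phi> \<in> smooth_torus" and \<psi>: "\<psi> \<in> smooth_torus"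
  shows "of_coeffs a (\<lambda>x. s * \<phi> x + t * \<psi> x) = s * of_coeffs a \<phi> + t * of_coeffs a \<psi>"
proof -
  have sum: "(\<lambda>\<xi>. a \<xi> * fourier_coeff \<phi> (- \<xi>)) summable_on UNIV" if "\<phi> \<in> smooth_torus" for \<phi>
    using smooth_torus_bounded[OF bessel_funpow_smooth[OF that]] of_coeffs_estimate(1)[OF a that] by metis
  have "fourier_coeff (\<lambda>x. s * \<phi> x + t * \<psi> x) \<xi> = s * fourier_coeff \<phi> \<xi> + t * fourier_coeff \<psi> \<xi>" for \<xi>
    by (intro fourier_coeff_lincomb smooth_torus_continuous \<phi> \<psi>)
  then have "(\<Sum>\<^sub>\<infinity>\<xi>. a \<xi> * fourier_coeff (\<lambda>x. s * \<phi> x + t * \<psi> x) (- \<xi>)) =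
      (\<Sum>\<^sub>\<infinity>\<xi>. s * (a \<xi> * fourier_coeff \<phi> (- \<xi>)) + t * (a \<xi> * fourier_coeff \<psi> (- \<xi>)))"
    by (simp add: algebra_simps)
  also have "\<dots> = s * (\<Sum>\<^sub>\<infinity>\<xi>. a \<xi> * fourier_coeff \<phi> (- \<xi>)) + t * (\<Sum>\<^sub>\<infinity>\<xi>. a \<xi> * fourier_coeff \<psi> (- \<xi>))"
    by (subst infsum_add) (auto simp: infsum_cmult_right' intro!: summable_on_cmult_right sum \<phi> \<psi>)
  finally show ?thesis
    using \<phi> \<psi> by (simp add: of_coeffs_def smooth_torus_lincomb algebra_simps)
qed

lemma of_coeffs_distributions:
  assumes a: "\<And>\<xi>. norm (a \<xi>) \<le> C * weight \<xi> ^ M"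
  shows "of_coeffs a \<in> distributions"
proof -
  let ?K = "(2 * pi)\<^sup>2 * (C * (\<Sum>\<^sub>\<infinity>\<xi>. 1 / (weight \<xi>)\<^sup>2))"
  note lin = of_coeffs_lincomb[OF a]
  have "of_coeffs a (\<lambda>x. \<phi> x + \<psi> x) = of_coeffs a \<phi> + of_coeffs a \<psi>"
    if "\<phi> \<in> smooth_torus" "\<psi> \<in> smooth_torus" for \<phi> \<psi>
    using lin[OF that, of 1 1] by simp
  moreover have "of_coeffs a (\<lambda>x. c * \<phi> x) = c * of_coeffs a \<phi>" if "\<phi> \<in> smooth_torus" for \<phi> c
    using lin[OF that that, of c 0] by simp
  moreover have "(\<lambda>n. of_coeffs a (F n)) \<longlonglongrightarrow> of_coeffs a \<phi>"
    if \<phi>: "\<phi> \<in> smooth_torus" and F: "\<And>n. F n \<in> smooth_torus" and conv: "smooth_converges F \<phi>" for F \<phi>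
  proof (rule tendstoI)
    fix e :: real
    assume e: "0 < e"
    \<comment> \<open>The summand 1 makes the denominator positive and the last estimate strict,
      whatever the value of \<open>?K\<close>.\<close>
    define d where "d = e / (\<bar>?K\<bar> + 1)"
    have d: "0 < d" using e by (simp add: d_def)
    have "uniform_limit UNIV (\<lambda>n. (bessel ^^ (M + 2)) (F n)) ((bessel ^^ (M + 2)) \<phi>) sequentially"
      using smooth_converges_bessel_funpow[OF conv F \<phi>, of "M + 2"]
      unfolding smooth_converges_def by (drule_tac bspec[of _ _ "[]"]) (simp_all only: pdiffs_def foldr.simps id_apply lists.Nil)
    then have "\<forall>\<^sub>F n in sequentially. \<forall>x\<in>UNIV. dist ((bessel ^^ (M + 2)) (F n) x) ((bessel ^^ (M + 2)) \<phi> x) < d"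
      using d by (rule uniform_limitD)
    then show "\<forall>\<^sub>F n in sequentially. dist (of_coeffs a (F n)) (of_coeffs a \<phi>) < e"
    proof eventually_elim
      case (elim n)
      let ?g = "\<lambda>x. 1 * F n x + (-1) * \<phi> x"
      have "norm ((bessel ^^ (M + 2)) ?g x) \<le> d" for x
        using bspec[OF elim, of x] unfolding bessel_funpow_lincomb[OF F \<phi>] dist_norm
        by (simp del: funpow.simps add: funpow_add)
      from of_coeffs_estimate(2)[OF a smooth_torus_lincomb[OF F \<phi>] this]
      have "norm (of_coeffs a ?g) \<le> d * ?K"
        by (simp add: mult_ac)
      also have "\<dots> \<le> d * \<bar>?K\<bar>"
        using d by (intro mult_left_mono) auto
      also have "\<dots> < d * (\<bar>?K\<bar> + 1)"
        using d by simp
      also have "\<dots> = e"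
        by (simp add: d_def)
      finally show ?case
        unfolding lin[OF F \<phi>] by (simp add: dist_norm)
    qed
  qed
  moreover have "of_coeffs a \<in> extensional smooth_torus"
    unfolding of_coeffs_def by (rule restrict_extensional)
  ultimately show ?thesis
    unfolding distributions_def by blast
qed

lemma fourier_of_coeffs: "fourier (of_coeffs a) = a"
proof
  fix \<xi>
  have "(\<Sum>\<^sub>\<infinity>\<eta>. a \<eta> * fourier_coeff (character (- \<xi>)) (- \<eta>)) = (\<Sum>\<^sub>\<infinity>\<eta>\<in>{\<xi>}. a \<eta>)"
    by (rule infsum_cong_neutral) (auto simp: fourier_coeff_character)
  then show "fourier (of_coeffs a) \<xi> = a \<xi>"
    by (simp add: fourier_def of_coeffs_def character_smooth)
qed

section \<open>Convergence of Fourier series and uniqueness of distributions\<close>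

lemma periodic_shift:
  assumes "periodic f"
  shows "f (x + 2 * pi * of_int m, y + 2 * pi * of_int n) = f (x, y)"
proof -
  interpret x: periodic_fun_simple "\<lambda>x. f (x, z)" "2 * pi" for z
    by standard (use assms in \<open>simp add: periodic_def\<close>)
  interpret y: periodic_fun_simple "\<lambda>y. f (z, y)" "2 * pi" for z
    by standard (use assms in \<open>simp add: periodic_def\<close>)
  show ?thesis
    using x.plus_of_int y.plus_of_int by (simp add: mult.commute)
qed

text \<open>One representative serves all periodic functions simultaneously, so that two of them can
  be compared at the same point of the square.\<close>

lemma square_representative:
  obtains y where "y \<in> square" "\<And>f. periodic f \<Longrightarrow> f y = f x"
proof -
  let ?r = "\<lambda>t. t + 2 * pi * of_int (- \<lfloor>t / (2 * pi)\<rfloor>)"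
  have r: "0 \<le> ?r t" "?r t \<le> 2 * pi" for t
  proof -
    have "of_int \<lfloor>t / (2 * pi)\<rfloor> \<le> t / (2 * pi)" "t / (2 * pi) \<le> of_int \<lfloor>t / (2 * pi)\<rfloor> + 1"
      by linarith+
    then have "of_int \<lfloor>t / (2 * pi)\<rfloor> * (2 * pi) \<le> t" "t \<le> (of_int \<lfloor>t / (2 * pi)\<rfloor> + 1) * (2 * pi)"
      by (simp_all only: pos_le_divide_eq pos_divide_le_eq pi_gt_zero mult_pos_pos zero_less_numeral)
    then show "0 \<le> ?r t" "?r t \<le> 2 * pi"
      by (simp_all add: algebra_simps)
  qed
  show thesis
  proof (rule that[of "(?r (fst x), ?r (snd x))"])
    show "(?r (fst x), ?r (snd x)) \<in> square"
      using r by (simp only: cbox_Pair_eq) simp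
  qed (simp only: periodic_shift prod.collapse)
qed

text \<open>A sequence cofinal among the finite sets of frequencies: it turns unordered sums into
  the limits along \<open>nat\<close> that \<open>smooth_converges\<close> speaks of.\<close>

definition freq_box :: "nat \<Rightarrow> (int \<times> int) set"
  where "freq_box n = {- int n..int n} \<times> {- int n..int n}"

lemma finite_freq_box [simp]: "finite (freq_box n)"
  by (simp add: freq_box_def)

lemma filterlim_freq_box: "filterlim freq_box (finite_subsets_at_top UNIV) sequentially"
  unfolding filterlim_finite_subsets_at_top
proof (intro allI impI)
  fix X :: "(int \<times> int) set"
  assume X: "finite X \<and> X \<subseteq> UNIV"
  define m where "m = Max (insert 0 ((\<lambda>\<xi>. max \<bar>fst \<xi>\<bar> \<bar>snd \<xi>\<bar>) ` X))"
  have m: "max \<bar>fst \<xi>\<bar> \<bar>snd \<xi>\<bar> \<le> m" if "\<xi> \<in> X" for \<xi>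
    unfolding m_def using X that by (intro Max_ge) auto
  have "X \<subseteq> freq_box n" if "nat m \<le> n" for n
    using m that by (fastforce simp: freq_box_def)
  then have "\<forall>\<^sub>F n in sequentially. X \<subseteq> freq_box n"
    by (rule eventually_sequentiallyI)
  then show "\<forall>\<^sub>F n in sequentially. finite (freq_box n) \<and> X \<subseteq> freq_box n \<and> freq_box n \<subseteq> UNIV"
    by simp
qed

definition fourier_partial_sum :: "(real \<times> real \<Rightarrow> complex) \<Rightarrow> nat \<Rightarrow> real \<times> real \<Rightarrow> complex"
  where "fourier_partial_sum \<phi> n x = (\<Sum>\<xi>\<in>freq_box n. fourier_coeff \<phi> \<xi> * character \<xi> x)"

lemma smooth_torus_sum:
  assumes "finite A" "\<And>i. i \<in> A \<Longrightarrow> f i \<in> smooth_torus"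
  shows "(\<lambda>x. \<Sum>i\<in>A. f i x) \<in> smooth_torus"
  using assms
proof (induction A)
  case empty
  show ?case using smooth_torus_scale[OF character_smooth, of 0] by simp
next
  case (insert i A)
  then show ?case by (simp add: smooth_torus_add)
qed

lemma fourier_partial_sum_smooth: "fourier_partial_sum \<phi> n \<in> smooth_torus"
  unfolding fourier_partial_sum_def
  by (intro smooth_torus_sum smooth_torus_scale character_smooth finite_freq_box)

lemma fourier_coeff_sum:
  assumes "finite A" "\<And>i. i \<in> A \<Longrightarrow> f i \<in> smooth_torus"
  shows "fourier_coeff (\<lambda>x. \<Sum>i\<in>A. f i x) \<xi> = (\<Sum>i\<in>A. fourier_coeff (f i) \<xi>)"
  using assms
proof (induction A)
  case empty
  show ?case by (simp add: fourier_coeff_def)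
next
  case (insert i A)
  then show ?case
    using fourier_coeff_lincomb[of "f i" "\<lambda>x. \<Sum>i\<in>A. f i x" 1 1 \<xi>]
    by (simp add: smooth_torus_sum smooth_torus_continuous)
qed

lemma fourier_coeff_partial_sum:
  "fourier_coeff (fourier_partial_sum \<phi> n) \<xi> = (if \<xi> \<in> freq_box n then fourier_coeff \<phi> \<xi> else 0)"
proof -
  have "fourier_coeff (\<lambda>x. c * character \<eta> x) \<xi> = c * (if \<eta> = \<xi> then 1 else 0)" for c \<eta>
    using fourier_coeff_lincomb[of "character \<eta>" "character \<eta>" c 0 \<xi>]
    by (simp add: fourier_coeff_character continuous_on_character)
  then show ?thesis
    unfolding fourier_partial_sum_def
    by (subst fourier_coeff_sum)
      (simp_all only: finite_freq_box smooth_torus_scale character_smooth,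
        simp add: if_distrib[of "\<lambda>y. _ * y"] cong: if_cong)
qed

text \<open>The decay for N = 2 and the M-test give uniform convergence to some continuous periodic
  \<open>g\<close>. Coefficients pass to the uniform limit, so \<open>g\<close> and
  \<open>\<phi>\<close> have the same ones; uniqueness identifies them on the square and periodicity
  everywhere.\<close>

lemma fourier_partial_sum_uniform_limit:
  assumes \<phi>: "\<phi> \<in> smooth_torus"
  shows "uniform_limit UNIV (fourier_partial_sum \<phi>) \<phi> sequentially"
proof -
  obtain B where B: "\<And>x. x \<in> square \<Longrightarrow> norm ((bessel ^^ 2) \<phi> x) \<le> B"
    using smooth_torus_bounded[OF bessel_funpow_smooth[OF \<phi>]] by metis
  define g where "g x = (\<Sum>\<^sub>\<infinity>\<xi>. fourier_coeff \<phi> \<xi> * character \<xi> x)" for x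
  have "uniform_limit UNIV (\<lambda>X x. \<Sum>\<xi>\<in>X. fourier_coeff \<phi> \<xi> * character \<xi> x) g (finite_subsets_at_top UNIV)"
    unfolding g_def
  proof (rule Weierstrass_m_test_general)
    show "norm (fourier_coeff \<phi> \<xi> * character \<xi> x) \<le> B * (1 / (weight \<xi>)\<^sup>2)" for \<xi> x
      using fourier_coeff_decay[OF \<phi> B] by (simp add: norm_mult)
    show "(\<lambda>\<xi>. B * (1 / (weight \<xi>)\<^sup>2)) summable_on UNIV"
      by (intro summable_on_cmult_right summable_on_inverse_weight_square)
  qed
  then have lim: "uniform_limit UNIV (fourier_partial_sum \<phi>) g sequentially"
    using filterlim_freq_box unfolding fourier_partial_sum_def by (rule filterlim_compose)
  have contg: "continuous_on S g" for S
  proof (rule continuous_on_subset)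
    show "continuous_on UNIV g"
      by (rule uniform_limit_theorem[OF _ lim])
        (simp_all add: smooth_torus_continuous fourier_partial_sum_smooth)
  qed simp
  have "periodic (\<lambda>x. character \<xi> x)" for \<xi> by (rule periodic_character)
  then have perg: "periodic g"
    unfolding periodic_def g_def by simp
  have "fourier_coeff g \<xi> = fourier_coeff \<phi> \<xi>" for \<xi>
  proof (rule LIMSEQ_unique)
    show "(\<lambda>n. fourier_coeff (fourier_partial_sum \<phi> n) \<xi>) \<longlonglongrightarrow> fourier_coeff g \<xi>"
    proof (rule tendstoI)
      fix e :: real
      assume "0 < e"
      then have "\<forall>\<^sub>F n in sequentially. \<forall>x\<in>UNIV. dist (fourier_partial_sum \<phi> n x) (g x) < e / 2"
        by (intro uniform_limitD[OF lim]) simp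
      then show "\<forall>\<^sub>F n in sequentially. dist (fourier_coeff (fourier_partial_sum \<phi> n) \<xi>) (fourier_coeff g \<xi>) < e"
      proof eventually_elim
        case (elim n)
        let ?S = "fourier_partial_sum \<phi> n"
        have c: "continuous_on square ?S"
          by (intro smooth_torus_continuous fourier_partial_sum_smooth)
        have "norm (fourier_coeff (\<lambda>x. 1 * ?S x + (-1) * g x) \<xi>) \<le> e / 2"
          using elim by (intro norm_fourier_coeff_le continuous_intros c contg) (auto simp: dist_norm intro: less_imp_le)
        then show ?case
          using \<open>0 < e\<close> unfolding fourier_coeff_lincomb[OF c contg] by (simp add: dist_norm)
      qed
    qed
    have "\<forall>\<^sub>F n in sequentially. \<xi> \<in> freq_box n"
      using filterlim_freq_box unfolding filterlim_finite_subsets_at_top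
      by (auto dest!: spec[of _ "{\<xi>}"] elim: eventually_mono)
    then show "(\<lambda>n. fourier_coeff (fourier_partial_sum \<phi> n) \<xi>) \<longlonglongrightarrow> fourier_coeff \<phi> \<xi>"
      by (intro tendsto_eventually) (simp add: fourier_coeff_partial_sum eventually_mono)
  qed
  then have z: "fourier_coeff (\<lambda>x. 1 * g x + (-1) * \<phi> x) \<xi> = 0" for \<xi>
    unfolding fourier_coeff_lincomb[OF contg smooth_torus_continuous[OF \<phi>]] by simp
  have per: "periodic (\<lambda>x. 1 * g x + (-1) * \<phi> x)"
    using perg smooth_torus_periodic[OF \<phi>] by (simp add: periodic_def)
  have "g x = \<phi> x" for x
  proof -
    obtain y where y: "y \<in> square" "\<And>f. periodic f \<Longrightarrow> f y = f x"
      using square_representative[of x] by blast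
    have "1 * g y + (-1) * \<phi> y = 0"
      by (rule fourier_coeff_unique_zero[OF per _ z y(1)])
        (intro continuous_intros contg smooth_torus_continuous \<phi>)
    then show ?thesis
      using y(2)[OF perg] y(2)[OF smooth_torus_periodic[OF \<phi>]] by simp
  qed
  then have "g = \<phi>" by blast
  with lim show ?thesis by simp
qed

lemma pdiffs_smooth: "\<lbrakk>\<phi> \<in> smooth_torus; vs \<in> lists Basis\<rbrakk> \<Longrightarrow> pdiffs vs \<phi> \<in> smooth_torus"
  by (induction vs) (auto simp: pdiffs_def smooth_torus_pdiff)

lemma pdiff_fourier_partial_sum:
  assumes "\<phi> \<in> smooth_torus" "v \<in> Basis"
  shows "pdiff v (fourier_partial_sum \<phi> n) = fourier_partial_sum (pdiff v \<phi>) n"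
proof
  fix x
  have *: "(fourier_partial_sum \<phi> n has_derivative
      (\<lambda>v. \<Sum>\<xi>\<in>freq_box n. pdiff v (\<lambda>x. fourier_coeff \<phi> \<xi> * character \<xi> x) x)) (at x)"
    unfolding fourier_partial_sum_def
    by (intro has_derivative_sum has_derivative_pdiff smooth_torus_differentiable_at
        smooth_torus_scale character_smooth)
  show "pdiff v (fourier_partial_sum \<phi> n) x = fourier_partial_sum (pdiff v \<phi>) n x"
    unfolding pdiff_def[of v "fourier_partial_sum \<phi> n"] frechet_derivative_at[OF *, symmetric]
    unfolding fourier_partial_sum_def pdiff_character fourier_coeff_pdiff_smooth[OF assms]
    by (simp add: freq_def mult_ac)
qed

lemma pdiffs_fourier_partial_sum:
  assumes "\<phi> \<in> smooth_torus" "vs \<in> lists Basis"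
  shows "pdiffs vs (fourier_partial_sum \<phi> n) = fourier_partial_sum (pdiffs vs \<phi>) n"
  using assms(2)
proof (induction vs)
  case Nil
  show ?case by (simp add: pdiffs_def)
next
  case (Cons v vs)
  have "pdiffs (v # vs) \<psi> = pdiff v (pdiffs vs \<psi>)" for \<psi>
    by (simp add: pdiffs_def)
  with Cons show ?case
    by (simp add: pdiff_fourier_partial_sum pdiffs_smooth assms)
qed

text \<open>Partial sums commute with derivatives, so uniform convergence applied to every
  derivative of \<open>\<phi>\<close> is already smooth convergence.\<close>

lemma fourier_partial_sum_smooth_converges:
  "\<phi> \<in> smooth_torus \<Longrightarrow> smooth_converges (fourier_partial_sum \<phi>) \<phi>"
  unfolding smooth_converges_def
  by (simp add: pdiffs_fourier_partial_sum fourier_partial_sum_uniform_limit pdiffs_smooth)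

lemma distributions_sum:
  assumes u: "u \<in> distributions" and "finite A" "\<And>i. i \<in> A \<Longrightarrow> f i \<in> smooth_torus"
  shows "u (\<lambda>x. \<Sum>i\<in>A. f i x) = (\<Sum>i\<in>A. u (f i))"
  using assms(2,3)
proof (induction A)
  case empty
  show ?case using distributions_scale[OF u character_smooth, of 0] by simp
next
  case (insert i A)
  then show ?case by (simp add: distributions_add[OF u] smooth_torus_sum)
qed

text \<open>Equal coefficients give equal values on characters, hence on Fourier partial sums, and
  sequential continuity carries this to every smooth function. Elsewhere both functionals are
  \<open>undefined\<close>.\<close>

lemma distributions_eqI:
  assumes u: "u \<in> distributions" and v: "v \<in> distributions" and eq: "\<And>\<xi>. fourier u \<xi> = fourier v \<xi>"
  shows "u = v"
proof (rule extensionalityI)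
  show "u \<in> extensional smooth_torus" "v \<in> extensional smooth_torus"
    using u v by (simp_all add: distributions_def)
  fix \<phi>
  assume \<phi>: "\<phi> \<in> smooth_torus"
  have char: "u (character \<xi>) = v (character \<xi>)" for \<xi>
    using eq[of "- \<xi>"] by (simp add: fourier_def)
  have expand: "w (fourier_partial_sum \<phi> n) = (\<Sum>\<xi>\<in>freq_box n. fourier_coeff \<phi> \<xi> * w (character \<xi>))"
    if "w \<in> distributions" for w n
    unfolding fourier_partial_sum_def
    by (subst distributions_sum[OF that])
      (simp_all add: distributions_scale[OF that] smooth_torus_scale character_smooth)
  then have "u (fourier_partial_sum \<phi> n) = v (fourier_partial_sum \<phi> n)" for n
    by (simp only: expand[OF u] expand[OF v] char)
  moreover have lim: "(\<lambda>n. w (fourier_partial_sum \<phi> n)) \<longlonglongrightarrow> w \<phi>" if "w \<in> distributions" for w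
    by (intro distributions_tendsto that \<phi> fourier_partial_sum_smooth fourier_partial_sum_smooth_converges)
  ultimately show "u \<phi> = v \<phi>"
    using LIMSEQ_unique[OF lim[OF u]] lim[OF v] by simp
qed

subsection \<open>Lower bounds on the symbol\<close>

definition symbol :: "complex \<Rightarrow> int \<times> int \<Rightarrow> complex"
  where "symbol \<alpha> \<xi> = \<i> * (of_int (fst \<xi>) - \<alpha> * of_int (snd \<xi>))"

lemma fourier_vector_field_symbol:
  "u \<in> distributions \<Longrightarrow> fourier (vector_field \<alpha> u) \<xi> = symbol \<alpha> \<xi> * fourier u \<xi>"
  by (simp add: fourier_vector_field symbol_def)

lemma norm_symbol: "norm (symbol \<alpha> \<xi>) = norm (of_int (fst \<xi>) - \<alpha> * of_int (snd \<xi>))"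
  by (simp add: symbol_def norm_mult)

lemma sobolev_iff:
  "u \<in> sobolev k \<longleftrightarrow> u \<in> distributions \<and> (\<lambda>\<xi>. weight \<xi> powr k * (norm (fourier u \<xi>))\<^sup>2) summable_on UNIV"
  by (simp add: sobolev_def weight_def)

lemma powr_half_square: "0 \<le> x \<Longrightarrow> (x powr (s / 2))\<^sup>2 = x powr (s :: real)"
  by (simp add: power2_eq_square powr_add[symmetric])

text \<open>Squaring the hypothesis turns the exponent s / 2 into the gain \<open>s\<close> of the
  Sobolev weight. The exceptional set \<open>E\<close> adds only finitely many terms.\<close>

lemma sobolev_gain:
  assumes u: "u \<in> distributions" and f: "f \<in> sobolev k" and C: "0 < C" and E: "finite E"
    and le: "\<And>\<xi>. \<xi> \<notin> E \<Longrightarrow> C * weight \<xi> powr (s / 2) * norm (fourier u \<xi>) \<le> norm (fourier f \<xi>)"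
  shows "u \<in> sobolev (k + s)"
proof -
  let ?g = "\<lambda>\<xi>. weight \<xi> powr (k + s) * (norm (fourier u \<xi>))\<^sup>2"
  have "(\<lambda>\<xi>. 1 / C\<^sup>2 * (weight \<xi> powr k * (norm (fourier f \<xi>))\<^sup>2)) summable_on UNIV"
    using f by (intro summable_on_cmult_right) (simp add: sobolev_iff)
  then have "(\<lambda>\<xi>. 1 / C\<^sup>2 * (weight \<xi> powr k * (norm (fourier f \<xi>))\<^sup>2)) summable_on - E"
    by (rule summable_on_subset_banach) simp
  then have "?g summable_on - E"
  proof (rule summable_on_comparison_test)
    fix \<xi>
    assume "\<xi> \<in> - E"
    then have "(C * weight \<xi> powr (s / 2) * norm (fourier u \<xi>))\<^sup>2 \<le> (norm (fourier f \<xi>))\<^sup>2"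
      using C by (intro power_mono le) auto
    then have "C\<^sup>2 * weight \<xi> powr s * (norm (fourier u \<xi>))\<^sup>2 \<le> (norm (fourier f \<xi>))\<^sup>2"
      using weight_pos[of \<xi>] by (simp add: power_mult_distrib powr_half_square less_imp_le)
    then have "weight \<xi> powr s * (norm (fourier u \<xi>))\<^sup>2 \<le> 1 / C\<^sup>2 * (norm (fourier f \<xi>))\<^sup>2"
      using C by (simp add: field_simps)
    from mult_left_mono[OF this, of "weight \<xi> powr k"]
    show "?g \<xi> \<le> 1 / C\<^sup>2 * (weight \<xi> powr k * (norm (fourier f \<xi>))\<^sup>2)"
      by (simp add: powr_add mult_ac)
  qed simp
  then have "?g summable_on (- E \<union> E)"
    using E by (intro summable_on_Un_disjoint) auto
  then show ?thesis
    using u by (simp add: sobolev_iff)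
qed

text \<open>Where the symbol vanishes the equation says nothing about \<open>u\<close>; these
  frequencies form the exceptional set in \<open>sobolev_gain\<close>.\<close>

lemma GH_of_symbol_lower_bound:
  assumes C: "0 < C" and fin: "finite {\<xi>. symbol \<alpha> \<xi> = 0}"
    and bound: "\<And>\<xi>. symbol \<alpha> \<xi> \<noteq> 0 \<Longrightarrow> C * weight \<xi> powr ((1 - r) / 2) \<le> norm (symbol \<alpha> \<xi>)"
  shows "GH \<alpha> r"
  unfolding GH_def
proof (intro allI ballI impI)
  fix k u
  assume u: "u \<in> distributions" and f: "vector_field \<alpha> u \<in> sobolev k"
  have "u \<in> sobolev (k + (1 - r))"
    by (rule sobolev_gain[OF u f C fin])
      (use bound in \<open>auto simp: fourier_vector_field_symbol[OF u] norm_mult intro!: mult_right_mono\<close>)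
  then show "u \<in> sobolev (k + 1 - r)"
    by (simp add: algebra_simps)
qed

text \<open>One term of a convergent nonnegative series is at most its sum. The resulting pointwise
  bound provides the polynomial growth assumed in \<open>of_coeffs_distributions\<close>.\<close>

lemma sobolev_fourier_bound:
  assumes "f \<in> sobolev k"
  obtains K where "0 \<le> K" "\<And>\<xi>. norm (fourier f \<xi>) \<le> K * weight \<xi> powr (- k / 2)"
proof
  let ?S = "\<Sum>\<^sub>\<infinity>\<xi>. weight \<xi> powr k * (norm (fourier f \<xi>))\<^sup>2"
  have sum: "(\<lambda>\<xi>. weight \<xi> powr k * (norm (fourier f \<xi>))\<^sup>2) summable_on UNIV"
    using assms by (simp add: sobolev_iff)
  show "0 \<le> sqrt ?S"
    by (simp add: infsum_nonneg)
  fix \<xi>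
  have "weight \<xi> powr k * (norm (fourier f \<xi>))\<^sup>2 \<le> ?S"
    using finite_sum_le_infsum[OF sum, of "{\<xi>}"] by simp
  then have "(weight \<xi> powr (k / 2) * norm (fourier f \<xi>))\<^sup>2 \<le> ?S"
    using weight_pos[of \<xi>] by (simp add: power_mult_distrib powr_half_square less_imp_le)
  then have "weight \<xi> powr (k / 2) * norm (fourier f \<xi>) \<le> sqrt ?S"
    by (rule real_le_rsqrt)
  from mult_right_mono[OF this, of "weight \<xi> powr (- k / 2)"]
  show "norm (fourier f \<xi>) \<le> sqrt ?S * weight \<xi> powr (- k / 2)"
    using weight_pos[of \<xi>] by (simp add: powr_minus field_simps)
qed

lemma weight_powr_le_power: "weight \<xi> powr s \<le> weight \<xi> ^ nat \<lceil>s\<rceil>"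
proof -
  have "weight \<xi> powr s \<le> weight \<xi> powr real (nat \<lceil>s\<rceil>)"
    by (intro powr_mono weight_ge_1) linarith
  then show ?thesis
    using weight_pos[of \<xi>] by (simp add: powr_realpow)
qed

text \<open>The transpose has the symbol of the opposite frequency. Since
  \<open>fourier f \<xi>\<close> tests \<open>f\<close> against this very character, it vanishes for
  \<open>f\<close> in the annihilator.\<close>

lemma character_smooth_kernel_transpose:
  "symbol \<alpha> \<xi> = 0 \<Longrightarrow> character (- \<xi>) \<in> smooth_kernel_transpose \<alpha>"
  by (simp add: smooth_kernel_transpose_def character_smooth vector_field_transpose_character symbol_def)

lemma GS_of_symbol_lower_bound:
  assumes C: "0 < C"
    and bound: "\<And>\<xi>. symbol \<alpha> \<xi> \<noteq> 0 \<Longrightarrow> C * weight \<xi> powr ((1 - r) / 2) \<le> norm (symbol \<alpha> \<xi>)"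
  shows "GS \<alpha> r"
  unfolding GS_def
proof (intro allI ballI)
  fix k f
  assume f: "f \<in> sobolev k \<inter> annihilator (smooth_kernel_transpose \<alpha>)"
  then have fd: "f \<in> distributions"
    by (simp add: sobolev_iff)
  have zero: "fourier f \<xi> = 0" if "symbol \<alpha> \<xi> = 0" for \<xi>
    using f character_smooth_kernel_transpose[OF that] by (simp add: annihilator_def fourier_def)
  \<comment> \<open>At zeros of the symbol the quotient is 0 by the convention for division; the
    equation survives because \<open>f\<close> has coefficient 0 there.\<close>
  define a where "a \<xi> = fourier f \<xi> / symbol \<alpha> \<xi>" for \<xi>
  have a: "symbol \<alpha> \<xi> * a \<xi> = fourier f \<xi>" for \<xi>
    using zero[of \<xi>] by (cases "symbol \<alpha> \<xi> = 0") (simp_all add: a_def)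
  have gain: "C * weight \<xi> powr ((1 - r) / 2) * norm (a \<xi>) \<le> norm (fourier f \<xi>)" for \<xi>
  proof (cases "symbol \<alpha> \<xi> = 0")
    case True
    then show ?thesis by (simp add: a_def)
  next
    case False
    from mult_right_mono[OF bound[OF this], of "norm (a \<xi>)"] show ?thesis
      by (simp add: norm_mult[symmetric] a)
  qed
  obtain K where K: "0 \<le> K" "\<And>\<xi>. norm (fourier f \<xi>) \<le> K * weight \<xi> powr (- k / 2)"
    using f sobolev_fourier_bound by blast
  have "norm (a \<xi>) \<le> K / C * weight \<xi> ^ nat \<lceil>- k / 2 - (1 - r) / 2\<rceil>" for \<xi>
  proof -
    have "norm (a \<xi>) * (C * weight \<xi> powr ((1 - r) / 2)) \<le> K * weight \<xi> powr (- k / 2)"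
      using order_trans[OF gain K(2)] by (simp add: mult_ac)
    then have "norm (a \<xi>) \<le> K * weight \<xi> powr (- k / 2) / (C * weight \<xi> powr ((1 - r) / 2))"
      using C weight_pos[of \<xi>] by (subst pos_le_divide_eq) auto
    also have "\<dots> = K / C * weight \<xi> powr (- k / 2 - (1 - r) / 2)"
      by (simp add: powr_diff)
    also have "\<dots> \<le> K / C * weight \<xi> ^ nat \<lceil>- k / 2 - (1 - r) / 2\<rceil>"
      using K(1) C by (intro mult_left_mono weight_powr_le_power) auto
    finally show ?thesis .
  qed
  then have u: "of_coeffs a \<in> distributions"
    by (rule of_coeffs_distributions)
  have "of_coeffs a \<in> sobolev (k + (1 - r))"
    using f gain by (intro sobolev_gain[OF u _ C finite.emptyI]) (auto simp: fourier_of_coeffs)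
  moreover have "vector_field \<alpha> (of_coeffs a) = f"
    by (intro distributions_eqI vector_field_distributions u fd)
      (simp add: fourier_vector_field_symbol[OF u] fourier_of_coeffs a)
  ultimately show "\<exists>u\<in>sobolev (k + 1 - r). vector_field \<alpha> u = f"
    by (auto simp: algebra_simps)
qed

section \<open>Small symbol values as an obstruction to GH and GS\<close>

lemma finite_weight_le: "finite {\<xi>. weight \<xi> \<le> R}"
proof (rule finite_subset)
  show "{\<xi>. weight \<xi> \<le> R} \<subseteq> {- \<lceil>R\<rceil>..\<lceil>R\<rceil>} \<times> {- \<lceil>R\<rceil>..\<lceil>R\<rceil>}"
  proof
    fix \<xi>
    assume \<xi>: "\<xi> \<in> {\<xi>. weight \<xi> \<le> R}"
    have sq: "\<bar>real_of_int a\<bar> \<le> (real_of_int a)\<^sup>2" for a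
    proof (cases "a = 0")
      case False
      then have "1 \<le> \<bar>real_of_int a\<bar>" by linarith
      from mult_left_mono[OF this, of "\<bar>real_of_int a\<bar>"] show ?thesis
        by (simp add: power2_eq_square)
    qed simp
    have "\<bar>real_of_int (fst \<xi>)\<bar> \<le> R" "\<bar>real_of_int (snd \<xi>)\<bar> \<le> R"
      using \<xi> sq[of "fst \<xi>"] sq[of "snd \<xi>"] zero_le_power2[of "real_of_int (fst \<xi>)"]
        zero_le_power2[of "real_of_int (snd \<xi>)"] unfolding weight_def mem_Collect_eq by linarith+
    then have "\<bar>fst \<xi>\<bar> \<le> \<lceil>R\<rceil>" "\<bar>snd \<xi>\<bar> \<le> \<lceil>R\<rceil>"
      by linarith+
    then show "\<xi> \<in> {- \<lceil>R\<rceil>..\<lceil>R\<rceil>} \<times> {- \<lceil>R\<rceil>..\<lceil>R\<rceil>}"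
      by (cases \<xi>) auto
  qed
qed simp

text \<open>Each bound on \<open>weight\<close> leaves only finitely many frequencies, so for every
  \<open>n\<close> some element of \<open>S\<close> has \<open>weight \<xi> powr e\<close> above
  \<open>2 ^ n\<close>. These choices are dominated by a geometric series.\<close>

lemma sparse_subset:
  assumes S: "infinite S" and e: "0 < e"
  obtains T where "T \<subseteq> S" "infinite T" "(\<lambda>\<xi>. weight \<xi> powr (- e)) summable_on T"
proof -
  have large: "\<exists>\<xi>\<in>S. 2 ^ n < weight \<xi> powr e" for n :: nat
  proof (rule ccontr)
    assume "\<not> ?thesis"
    then have le: "weight \<xi> powr e \<le> 2 ^ n" if "\<xi> \<in> S" for \<xi>
      using that by force
    have "weight \<xi> \<le> (2 ^ n) powr (1 / e)" if "\<xi> \<in> S" for \<xi>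
    proof -
      have "(weight \<xi> powr e) powr (1 / e) \<le> (2 ^ n) powr (1 / e)"
        using e by (intro powr_mono2 le that) auto
      then show ?thesis
        using e weight_pos[of \<xi>] by (simp add: powr_powr)
    qed
    then have "S \<subseteq> {\<xi>. weight \<xi> \<le> (2 ^ n) powr (1 / e)}"
      by blast
    with S finite_subset[OF _ finite_weight_le] show False by blast
  qed
  define g where "g n = (SOME \<xi>. \<xi> \<in> S \<and> 2 ^ n < weight \<xi> powr e)" for n :: nat
  have "g n \<in> S \<and> 2 ^ n < weight (g n) powr e" for n
    unfolding g_def by (rule someI_ex) (use large[of n] in blast)
  then have g: "g n \<in> S" "2 ^ n < weight (g n) powr e" for n
    by simp_all
  \<comment> \<open>The choices \<open>g n\<close> may coincide; \<open>N\<close> keeps one index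
    for each value, so that reindexing is along an injection.\<close>
  obtain N where N: "inj_on g N" "range g = g ` N"
    by (rule exE[OF iffD1[OF subset_image_inj subset_refl[of "range g"]]]) (elim conjE, rule that)
  show thesis
  proof
    show "range g \<subseteq> S" by (intro image_subsetI g)
    show "infinite (range g)"
    proof
      assume fin: "finite (range g)"
      define R where "R = Max ((\<lambda>\<xi>. weight \<xi> powr e) ` range g)"
      obtain n where "R < 2 ^ n"
        using real_arch_pow[of 2 R] by auto
      moreover have "weight (g n) powr e \<le> R"
        unfolding R_def using fin by (intro Max_ge) auto
      ultimately show False using g(2)[of n] by linarith
    qed
    have "(\<lambda>n. (1 / 2) ^ n :: real) summable_on UNIV"
      by (rule norm_summable_imp_summable_on) (simp add: summable_geometric)
    then have "(\<lambda>n. (1 / 2) ^ n :: real) summable_on N"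
      by (rule summable_on_subset_banach) simp
    then have "((\<lambda>\<xi>. weight \<xi> powr (- e)) \<circ> g) summable_on N"
    proof (rule summable_on_comparison_test)
      show "((\<lambda>\<xi>. weight \<xi> powr (- e)) \<circ> g) n \<le> (1 / 2) ^ n" for n
      proof -
        have "inverse (weight (g n) powr e) \<le> inverse (2 ^ n)"
          by (intro le_imp_inverse_le less_imp_le g(2)) simp
        then show ?thesis
          by (simp add: powr_minus power_one_over inverse_eq_divide)
      qed
    qed simp
    then show "(\<lambda>\<xi>. weight \<xi> powr (- e)) summable_on range g"
      unfolding N(2) summable_on_reindex[OF N(1)] .
  qed
qed

text \<open>
  The frequencies are chosen so sparse that the gap between \<open>r\<close> and \<open>r'\<close> makes the image square
  summable.
\<close>

lemma singular_distribution:
  assumes S: "infinite S" and r: "r < r'"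
    and le: "\<And>\<xi>. \<xi> \<in> S \<Longrightarrow> norm (symbol \<alpha> \<xi>) \<le> D * weight \<xi> powr ((1 - r') / 2)"
  obtains T u where "T \<subseteq> S" "infinite T" "u \<in> distributions" "vector_field \<alpha> u \<in> sobolev 0"
    "\<And>\<xi>. \<xi> \<in> T \<Longrightarrow> norm (fourier u \<xi>) = weight \<xi> powr ((r - 1) / 2)"
proof -
  obtain T where T: "T \<subseteq> S" "infinite T" "(\<lambda>\<xi>. weight \<xi> powr (- (r' - r))) summable_on T"
    using sparse_subset[OF S, of "r' - r"] r by auto
  \<comment> \<open>With this exponent each frequency of \<open>T\<close> contributes exactly 1 to
    the Sobolev sum of order 1 - r, while the symbol bound makes the squared coefficients of the
    image at most a multiple of \<open>weight \<xi> powr (- (r' - r))\<close>.\<close>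
  define a :: "int \<times> int \<Rightarrow> complex"
    where "a \<xi> = (if \<xi> \<in> T then of_real (weight \<xi> powr ((r - 1) / 2)) else 0)" for \<xi>
  have "norm (a \<xi>) \<le> 1 * weight \<xi> ^ nat \<lceil>(r - 1) / 2\<rceil>" for \<xi>
    using weight_powr_le_power[of \<xi> "(r - 1) / 2"] weight_pos[of \<xi>] by (simp add: a_def)
  then have u: "of_coeffs a \<in> distributions"
    by (rule of_coeffs_distributions)
  let ?f = "vector_field \<alpha> (of_coeffs a)"
  have "(\<lambda>\<xi>. D\<^sup>2 * weight \<xi> powr (- (r' - r))) summable_on T"
    by (intro summable_on_cmult_right T)
  then have "(\<lambda>\<xi>. (norm (symbol \<alpha> \<xi> * a \<xi>))\<^sup>2) summable_on T"
  proof (rule summable_on_comparison_test)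
    fix \<xi>
    assume \<xi>: "\<xi> \<in> T"
    then have "norm (symbol \<alpha> \<xi> * a \<xi>) \<le> D * weight \<xi> powr ((1 - r') / 2) * weight \<xi> powr ((r - 1) / 2)"
      using le[OF subsetD[OF T(1) \<xi>]] by (simp add: norm_mult a_def mult_right_mono)
    also have "\<dots> = D * weight \<xi> powr (- (r' - r) / 2)"
      by (simp add: powr_add[symmetric] add_divide_distrib[symmetric])
    finally have "(norm (symbol \<alpha> \<xi> * a \<xi>))\<^sup>2 \<le> (D * weight \<xi> powr (- (r' - r) / 2))\<^sup>2"
      by (intro power_mono) auto
    then show "(norm (symbol \<alpha> \<xi> * a \<xi>))\<^sup>2 \<le> D\<^sup>2 * weight \<xi> powr (- (r' - r))"
      unfolding power_mult_distrib powr_half_square[OF less_imp_le[OF weight_pos]] .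
  qed simp
  then have "(\<lambda>\<xi>. (norm (symbol \<alpha> \<xi> * a \<xi>))\<^sup>2) summable_on UNIV"
    by (subst summable_on_cong_neutral[where T = T]) (auto simp: a_def)
  then have "?f \<in> sobolev 0"
    using weight_pos
    by (simp add: sobolev_iff vector_field_distributions u fourier_vector_field_symbol fourier_of_coeffs less_imp_neq[symmetric])
  with T u show thesis
    by (intro that[of T "of_coeffs a"]) (auto simp: fourier_of_coeffs a_def)
qed

text \<open>The exponents cancel, so the Sobolev sum restricted to \<open>T\<close> is a sum of
  ones.\<close>

lemma sobolev_lacunary_finite:
  assumes "v \<in> sobolev (1 - r)" "\<And>\<xi>. \<xi> \<in> T \<Longrightarrow> norm (fourier v \<xi>) = weight \<xi> powr ((r - 1) / 2)"
  shows "finite T"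
proof -
  have "(\<lambda>\<xi>. weight \<xi> powr (1 - r) * (norm (fourier v \<xi>))\<^sup>2) summable_on T"
    using assms(1) by (auto simp: sobolev_iff intro: summable_on_subset_banach)
  moreover have "weight \<xi> powr (1 - r) * (norm (fourier v \<xi>))\<^sup>2 = 1" if "\<xi> \<in> T" for \<xi>
    using weight_pos[of \<xi>] by (simp add: assms(2)[OF that] powr_half_square powr_add[symmetric])
  ultimately have sum: "(\<lambda>\<xi>. 1 :: real) summable_on T"
    using summable_on_cong[of T "\<lambda>\<xi>. weight \<xi> powr (1 - r) * (norm (fourier v \<xi>))\<^sup>2" "\<lambda>_. 1"] by simp
  show ?thesis
  proof (rule ccontr)
    assume "infinite T"
    obtain n where n: "(\<Sum>\<^sub>\<infinity>\<xi>\<in>T. 1) < real n"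
      using reals_Archimedean2 by blast
    obtain B where B: "finite B" "card B = n" "B \<subseteq> T"
      using infinite_arbitrarily_large[OF \<open>infinite T\<close>] by blast
    from finite_sum_le_infsum[OF sum B(1,3)] show False
      using n B(2) by simp
  qed
qed

lemma GH_imp_finite_small_symbol:
  assumes GH: "GH \<alpha> r" and r: "r < r'"
  shows "finite {\<xi>. norm (symbol \<alpha> \<xi>) \<le> D * weight \<xi> powr ((1 - r') / 2)}" (is "finite ?S")
proof (rule ccontr)
  assume "infinite ?S"
  then obtain T u where T: "infinite T" "u \<in> distributions" "vector_field \<alpha> u \<in> sobolev 0"
    "\<And>\<xi>. \<xi> \<in> T \<Longrightarrow> norm (fourier u \<xi>) = weight \<xi> powr ((r - 1) / 2)"
    using singular_distribution[of ?S r r' \<alpha> D] r by (smt (verit) mem_Collect_eq)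
  have "u \<in> sobolev (0 + 1 - r)"
    using GH T(2,3) unfolding GH_def by blast
  then show False
    using sobolev_lacunary_finite[of u r T] T(1,4) by simp
qed

lemma vector_field_annihilator:
  assumes "u \<in> distributions"
  shows "vector_field \<alpha> u \<in> annihilator (smooth_kernel_transpose \<alpha>)"
  unfolding annihilator_def
proof (intro CollectI conjI ballI vector_field_distributions assms)
  fix \<phi>
  assume "\<phi> \<in> smooth_kernel_transpose \<alpha>"
  \<comment> \<open>The zero function is written as a multiple of a character so that homogeneity
    gives it the value 0.\<close>
  then have "\<phi> \<in> smooth_torus" "vector_field_transpose \<alpha> \<phi> = (\<lambda>x. 0 * character 0 x)"
    by (auto simp: smooth_kernel_transpose_def)
  then show "vector_field \<alpha> u \<phi> = 0"
    using distributions_scale[OF assms character_smooth, of 0 0] by (simp add: vector_field_apply assms)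
qed

text \<open>The image of the singular \<open>u\<close> is an admissible right-hand side. Another
  solution \<open>v\<close> may differ from \<open>u\<close> on the zeros of the symbol, but on
  \<open>T\<close> the symbol is nonzero and fixes the coefficients, so \<open>v\<close> is just as
  singular.\<close>

lemma GS_imp_finite_small_symbol:
  assumes GS: "GS \<alpha> r" and r: "r < r'"
  shows "finite {\<xi>. symbol \<alpha> \<xi> \<noteq> 0 \<and> norm (symbol \<alpha> \<xi>) \<le> D * weight \<xi> powr ((1 - r') / 2)}" (is "finite ?S")
proof (rule ccontr)
  assume "infinite ?S"
  then obtain T u where T: "T \<subseteq> ?S" "infinite T" "u \<in> distributions" "vector_field \<alpha> u \<in> sobolev 0"
    "\<And>\<xi>. \<xi> \<in> T \<Longrightarrow> norm (fourier u \<xi>) = weight \<xi> powr ((r - 1) / 2)"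
    using singular_distribution[of ?S r r' \<alpha> D] r by (smt (verit) mem_Collect_eq)
  then have "vector_field \<alpha> u \<in> sobolev 0 \<inter> annihilator (smooth_kernel_transpose \<alpha>)"
    by (simp add: vector_field_annihilator)
  with GS obtain v where v: "v \<in> sobolev (0 + 1 - r)" "vector_field \<alpha> v = vector_field \<alpha> u"
    unfolding GS_def by blast
  have vd: "v \<in> distributions"
    using v(1) by (simp add: sobolev_iff)
  have "fourier v \<xi> = fourier u \<xi>" if "\<xi> \<in> T" for \<xi>
    using that T(1) fourier_vector_field_symbol[OF vd, of \<alpha> \<xi>] fourier_vector_field_symbol[OF T(3), of \<alpha> \<xi>]
    by (auto simp: v(2))
  then show False
    using sobolev_lacunary_finite[of v r T] T(2,5) v(1) by simp
qed

subsection \<open>Diophantine estimates\<close>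

text \<open>The coordinates of a nonzero integer vector have absolute values summing to at least 1,
  which absorbs the summand 1 in \<open>weight\<close>.\<close>

lemma sqrt_weight_le:
  assumes "\<xi> \<noteq> 0"
  shows "weight \<xi> powr (1 / 2) \<le> 2 * (\<bar>of_int (fst \<xi>)\<bar> + \<bar>of_int (snd \<xi>)\<bar>)"
proof -
  let ?a = "\<bar>real_of_int (fst \<xi>)\<bar>" and ?b = "\<bar>real_of_int (snd \<xi>)\<bar>"
  have "fst \<xi> \<noteq> 0 \<or> snd \<xi> \<noteq> 0"
    using assms by (auto simp: prod_eq_iff)
  then have "1 \<le> ?a + ?b"
    by linarith
  then have "1\<^sup>2 \<le> (?a + ?b)\<^sup>2"
    by (intro power_mono) auto
  moreover have "(of_int (fst \<xi>))\<^sup>2 + (of_int (snd \<xi>))\<^sup>2 \<le> (?a + ?b)\<^sup>2"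
    by (simp add: power2_sum)
  ultimately have "weight \<xi> \<le> 1 * (?a + ?b)\<^sup>2 + (?a + ?b)\<^sup>2"
    unfolding weight_def by simp
  also have "\<dots> \<le> (2 * (?a + ?b))\<^sup>2"
    unfolding power_mult_distrib by simp
  finally have "sqrt (weight \<xi>) \<le> 2 * (?a + ?b)"
    by (intro real_le_lsqrt) auto
  then show ?thesis
    using weight_pos[of \<xi>] by (simp add: powr_half_sqrt)
qed

lemma abs_snd_le_sqrt_weight: "\<bar>of_int (snd \<xi>)\<bar> \<le> weight \<xi> powr (1 / 2)"
proof -
  have "\<bar>of_int (snd \<xi>)\<bar> \<le> sqrt (weight \<xi>)"
    by (intro real_le_rsqrt) (simp add: weight_def)
  then show ?thesis
    using weight_pos[of \<xi>] by (simp add: powr_half_sqrt)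
qed

lemma norm_symbol_of_real: "norm (symbol (of_real a) \<xi>) = \<bar>of_int (fst \<xi>) - a * of_int (snd \<xi>)\<bar>"
proof -
  have "of_int (fst \<xi>) - of_real a * of_int (snd \<xi>) = complex_of_real (of_int (fst \<xi>) - a * of_int (snd \<xi>))"
    by simp
  then show ?thesis
    unfolding norm_symbol by (simp only: norm_of_real)
qed

text \<open>The imaginary part of \<open>of_int (fst \<xi>) - \<alpha> * of_int (snd \<xi>)\<close>
  controls the second coordinate, and the triangle inequality then controls the first.
  \<open>K\<close> collects these bounds with the factor 2 of \<open>sqrt_weight_le\<close>.\<close>

lemma elliptic_lower_bound:
  assumes "Im \<alpha> \<noteq> 0"
  obtains C where "0 < C" "\<And>\<xi>. \<xi> \<noteq> 0 \<Longrightarrow> C * weight \<xi> powr (1 / 2) \<le> norm (symbol \<alpha> \<xi>)"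
proof -
  define K where "K = 2 * (1 + (norm \<alpha> + 1) / \<bar>Im \<alpha>\<bar>)"
  have K: "0 < K"
    using assms by (simp add: K_def add_pos_nonneg)
  have "weight \<xi> powr (1 / 2) \<le> K * norm (symbol \<alpha> \<xi>)" if "\<xi> \<noteq> 0" for \<xi>
  proof -
    let ?z = "of_int (fst \<xi>) - \<alpha> * of_int (snd \<xi>)"
    let ?b = "\<bar>real_of_int (snd \<xi>)\<bar>"
    have "\<bar>Im \<alpha>\<bar> * ?b \<le> norm ?z"
      using abs_Im_le_cmod[of ?z] by (simp add: abs_mult)
    then have b: "?b \<le> norm ?z / \<bar>Im \<alpha>\<bar>"
      using assms by (simp add: pos_le_divide_eq mult.commute)
    have "\<bar>real_of_int (fst \<xi>)\<bar> \<le> norm ?z + norm \<alpha> * ?b"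
      using norm_triangle_ineq[of ?z "\<alpha> * of_int (snd \<xi>)"] by (simp add: norm_mult)
    then have "\<bar>real_of_int (fst \<xi>)\<bar> + ?b \<le> norm ?z + (norm \<alpha> + 1) * ?b"
      by (simp add: algebra_simps)
    also have "\<dots> \<le> norm ?z + (norm \<alpha> + 1) * (norm ?z / \<bar>Im \<alpha>\<bar>)"
      using b by (intro add_left_mono mult_left_mono) auto
    finally have le: "\<bar>real_of_int (fst \<xi>)\<bar> + ?b \<le> norm ?z + (norm \<alpha> + 1) * (norm ?z / \<bar>Im \<alpha>\<bar>)" .
    have eq: "K * norm ?z = 2 * (norm ?z + (norm \<alpha> + 1) * (norm ?z / \<bar>Im \<alpha>\<bar>))"
      using assms by (simp add: K_def field_simps)
    have "2 * (\<bar>real_of_int (fst \<xi>)\<bar> + ?b) \<le> K * norm ?z"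
      unfolding eq by (rule mult_left_mono[OF le]) simp
    then show ?thesis
      using sqrt_weight_le[OF that] by (simp add: norm_symbol)
  qed
  then show thesis
    using K by (intro that[of "1 / K"]) (simp_all add: field_simps)
qed

text \<open>The sign of \<open>t\<close> decides which inequality is monotonicity and which one
  costs a power of \<open>K\<close>; the exponent \<open>\<bar>t\<bar>\<close> covers both.\<close>

lemma powr_comparable:
  fixes x y K t :: real
  assumes "0 < x" "x \<le> y" "y \<le> K * x"
  shows "y powr t \<le> K powr \<bar>t\<bar> * x powr t" "x powr t \<le> K powr \<bar>t\<bar> * y powr t"
proof -
  have "x * 1 \<le> x * K"
    using order_trans[OF assms(2,3)] by (simp only: mult_1_right mult.commute[of x K])
  then have K: "1 \<le> K"
    by (rule iffD1[OF mult_le_cancel_left_pos[OF assms(1)]])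
  then have K1: "1 \<le> K powr \<bar>t\<bar>"
    by (simp add: ge_one_powr_ge_zero)
  have "y powr t \<le> K powr \<bar>t\<bar> * x powr t \<and> x powr t \<le> K powr \<bar>t\<bar> * y powr t"
  proof (cases "0 \<le> t")
    case True
    have "y powr t \<le> (K * x) powr t" "x powr t \<le> y powr t"
      using assms True by (auto intro: powr_mono2)
    moreover have "1 * y powr t \<le> K powr \<bar>t\<bar> * y powr t"
      by (intro mult_right_mono K1) simp
    ultimately show ?thesis
      using True K assms(1) by (simp add: powr_mult)
  next
    case False
    have "y powr t \<le> x powr t" "(K * x) powr t \<le> y powr t"
      using assms False by (auto intro: powr_mono2')
    moreover have "1 * x powr t \<le> K powr \<bar>t\<bar> * x powr t"
      by (intro mult_right_mono K1) simp
    moreover have "x powr t = K powr \<bar>t\<bar> * (K * x) powr t"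
      using False K assms(1) by (simp add: powr_mult powr_minus)
    moreover have "K powr \<bar>t\<bar> * (K * x) powr t \<le> K powr \<bar>t\<bar> * y powr t"
      using calculation(2) by (intro mult_left_mono) auto
    ultimately show ?thesis by linarith
  qed
  then show "y powr t \<le> K powr \<bar>t\<bar> * x powr t" "x powr t \<le> K powr \<bar>t\<bar> * y powr t"
    by blast+
qed

text \<open>Near the line the first coordinate is at most |a| + 1 times the second; adding the
  second gives |a| + 2, and the factor 2 is that of \<open>sqrt_weight_le\<close>.\<close>

lemma sqrt_weight_le_near_line:
  assumes "snd \<xi> \<noteq> 0" "\<bar>of_int (fst \<xi>) - a * of_int (snd \<xi>)\<bar> \<le> \<bar>of_int (snd \<xi>)\<bar>"
  shows "weight \<xi> powr (1 / 2) \<le> 2 * (\<bar>a\<bar> + 2) * \<bar>of_int (snd \<xi>)\<bar>"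
proof -
  have "\<xi> \<noteq> 0" using assms(1) by auto
  have "\<bar>of_int (fst \<xi>)\<bar> \<le> \<bar>of_int (fst \<xi>) - a * of_int (snd \<xi>)\<bar> + \<bar>a\<bar> * \<bar>of_int (snd \<xi>)\<bar>"
    unfolding abs_mult[symmetric] by linarith
  then have "\<bar>of_int (fst \<xi>)\<bar> + \<bar>of_int (snd \<xi>)\<bar> \<le> (\<bar>a\<bar> + 2) * \<bar>of_int (snd \<xi>)\<bar>"
    using assms(2) by (simp add: algebra_simps)
  then have "2 * (\<bar>of_int (fst \<xi>)\<bar> + \<bar>of_int (snd \<xi>)\<bar>) \<le> 2 * ((\<bar>a\<bar> + 2) * \<bar>of_int (snd \<xi>)\<bar>)"
    by (rule mult_left_mono) simp
  with sqrt_weight_le[OF \<open>\<xi> \<noteq> 0\<close>] show ?thesis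
    unfolding mult.assoc by (rule order_trans)
qed

lemma weight_powr_half: "weight \<xi> powr (s / 2) = (weight \<xi> powr (1 / 2)) powr s"
  by (simp add: powr_powr)

text \<open>Away from the line the symbol is elliptic; close to it \<open>weight \<xi>\<close> is comparable to the square of \<open>snd \<xi>\<close>.\<close>

lemma diophantine_lower_bound:
  assumes \<mu>: "0 < \<mu>" and c: "0 < c"
    and dio: "\<And>m n :: int. n \<noteq> 0 \<Longrightarrow> c * \<bar>of_int n\<bar> powr (1 - \<mu>) \<le> \<bar>of_int m - a * of_int n\<bar>"
  obtains C where "0 < C"
    "\<And>\<xi>. \<xi> \<noteq> 0 \<Longrightarrow> C * weight \<xi> powr ((1 - \<mu>) / 2) \<le> norm (symbol (of_real a) \<xi>)"
proof -
  define K where "K = 2 * (\<bar>a\<bar> + 2)"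
  define L where "L = K powr \<bar>1 - \<mu>\<bar>"
  have K: "0 < K" and L: "0 < L"
    by (simp_all add: K_def L_def add_nonneg_pos)
  have "min (1 / K) (c / L) * weight \<xi> powr ((1 - \<mu>) / 2) \<le> norm (symbol (of_real a) \<xi>)" if \<xi>: "\<xi> \<noteq> 0" for \<xi>
  proof -
    let ?p = "\<bar>of_int (fst \<xi>) - a * of_int (snd \<xi>)\<bar>" and ?n = "\<bar>real_of_int (snd \<xi>)\<bar>"
    let ?s = "weight \<xi> powr (1 / 2)"
    have s1: "1 \<le> ?s"
      using weight_ge_1[of \<xi>] by (simp add: ge_one_powr_ge_zero)
    show ?thesis
    proof (cases "?n \<le> ?p")
      case True
      have "?s \<le> 2 * (\<bar>of_int (fst \<xi>)\<bar> + ?n)"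
        by (rule sqrt_weight_le[OF \<xi>])
      also have "\<bar>of_int (fst \<xi>)\<bar> \<le> ?p + \<bar>a\<bar> * ?n"
        unfolding abs_mult[symmetric] by linarith
      also have "2 * (?p + \<bar>a\<bar> * ?n + ?n) = 2 * ?p + 2 * (\<bar>a\<bar> + 1) * ?n"
        by (simp add: algebra_simps)
      also have "\<dots> \<le> 2 * ?p + 2 * (\<bar>a\<bar> + 1) * ?p"
        using True by (intro add_left_mono mult_left_mono) auto
      also have "\<dots> = K * ?p"
        by (simp add: K_def algebra_simps)
      finally have "?s \<le> K * ?p" by simp
      then have "1 / K * ?s \<le> ?p"
        using K by (simp add: field_simps)
      \<comment> \<open>As \<open>?s\<close> is at least 1 and \<open>\<mu>\<close> is positive, the
        elliptic bound is at least as strong as the claimed one.\<close>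
      moreover have "?s powr (1 - \<mu>) \<le> ?s powr 1"
        using \<mu> by (intro powr_mono s1) simp
      then have "min (1 / K) (c / L) * ?s powr (1 - \<mu>) \<le> 1 / K * ?s"
        using K s1 by (intro mult_mono) auto
      ultimately show ?thesis
        unfolding norm_symbol_of_real weight_powr_half[of _ "1 - \<mu>"] by linarith
    next
      case False
      then have n: "snd \<xi> \<noteq> 0" by auto
      have "?s powr (1 - \<mu>) \<le> L * ?n powr (1 - \<mu>)"
        unfolding L_def K_def
        by (intro powr_comparable(1) abs_snd_le_sqrt_weight sqrt_weight_le_near_line)
          (use n False in auto)
      then have "c / L * ?s powr (1 - \<mu>) \<le> c / L * (L * ?n powr (1 - \<mu>))"
        using c L by (intro mult_left_mono) auto
      also have "\<dots> = c * ?n powr (1 - \<mu>)"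
        using L by simp
      also have "\<dots> \<le> ?p"
        by (rule dio[OF n])
      finally have "c / L * ?s powr (1 - \<mu>) \<le> ?p" .
      moreover have "min (1 / K) (c / L) * ?s powr (1 - \<mu>) \<le> c / L * ?s powr (1 - \<mu>)"
        by (intro mult_right_mono) auto
      ultimately show ?thesis
        unfolding norm_symbol_of_real weight_powr_half[of _ "1 - \<mu>"] by linarith
    qed
  qed
  then show thesis
    using K L c by (intro that[of "min (1 / K) (c / L)"]) simp_all
qed

definition good_approximations :: "real \<Rightarrow> real \<Rightarrow> real set"
  where "good_approximations a \<mu> = {q. \<exists>m n :: int. n \<noteq> 0 \<and> q = of_int m / of_int n \<and>
        0 < \<bar>a - q\<bar> \<and> \<bar>a - q\<bar> < 1 / \<bar>of_int n\<bar> powr \<mu>}"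

lemma abs_diff_fraction:
  fixes m n :: int
  assumes "n \<noteq> 0"
  shows "\<bar>of_int m - a * of_int n\<bar> = \<bar>a - of_int m / of_int n\<bar> * \<bar>of_int n :: real\<bar>"
proof -
  have "of_int m - a * of_int n = - ((a - of_int m / of_int n) * of_int n)"
    using assms by (simp add: field_simps)
  then show ?thesis by (simp add: abs_mult)
qed

text \<open>
  The finitely many exceptional fractions have infinitely many representations \<open>m / n\<close>, but stay at a
  positive distance from \<open>a\<close>.
\<close>

lemma finite_good_approximations_imp_bound:
  assumes a: "a \<notin> \<rat>" and \<mu>: "0 < \<mu>" and fin: "finite (good_approximations a \<mu>)"
  obtains c where "0 < c"
    "\<And>m n :: int. n \<noteq> 0 \<Longrightarrow> c * \<bar>of_int n\<bar> powr (1 - \<mu>) \<le> \<bar>of_int m - a * of_int n\<bar>"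
proof
  \<comment> \<open>The inserted 1 serves the fractions that are not exceptional and keeps the
    minimum defined when there are no exceptional ones.\<close>
  let ?c = "Min (insert 1 ((\<lambda>q. \<bar>a - q\<bar>) ` good_approximations a \<mu>))"
  show "0 < ?c"
    using fin by (subst Min_gr_iff) (auto simp: good_approximations_def)
  fix m n :: int
  assume n: "n \<noteq> 0"
  let ?q = "of_int m / of_int n :: real" and ?n = "\<bar>of_int n :: real\<bar>"
  have n1: "1 \<le> ?n" using n by linarith
  have "?q \<in> \<rat>" by simp
  then have pos: "0 < \<bar>a - ?q\<bar>" using a by auto
  have "?c * ?n powr (- \<mu>) \<le> \<bar>a - ?q\<bar>"
  proof (cases "?q \<in> good_approximations a \<mu>")
    case True
    have "?c * ?n powr (- \<mu>) \<le> \<bar>a - ?q\<bar> * 1"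
    proof (rule mult_mono)
      show "?c \<le> \<bar>a - ?q\<bar>"
        using fin True by (intro Min_le) auto
      have "?n powr (- \<mu>) \<le> ?n powr 0"
        using \<mu> by (intro powr_mono n1) simp
      then show "?n powr (- \<mu>) \<le> 1"
        using n by simp
    qed auto
    then show ?thesis by simp
  next
    case False
    then have "\<not> \<bar>a - ?q\<bar> < 1 / ?n powr \<mu>"
      using n pos unfolding good_approximations_def mem_Collect_eq by blast
    then have "1 / ?n powr \<mu> \<le> \<bar>a - ?q\<bar>"
      by (rule leI)
    moreover have "?c * ?n powr (- \<mu>) \<le> 1 * ?n powr (- \<mu>)"
      using fin by (intro mult_right_mono Min_le) auto
    ultimately show ?thesis
      by (simp add: powr_minus_divide)
  qed
  then have "?c * ?n powr (- \<mu>) * ?n \<le> \<bar>a - ?q\<bar> * ?n"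
    by (rule mult_right_mono) simp
  moreover have eq: "?n powr (- \<mu>) * ?n = ?n powr (1 - \<mu>)"
    using n powr_add[of ?n "- \<mu>" 1] by simp
  ultimately show "?c * ?n powr (1 - \<mu>) \<le> \<bar>of_int m - a * of_int n\<bar>"
    unfolding abs_diff_fraction[OF n] eq[symmetric] by (simp only: mult.assoc)
qed

text \<open>Multiplied by its denominator, a good approximation m / n becomes a small nonzero symbol
  value at (m, n), so the approximations are an image of \<open>?S\<close>. \<open>D\<close> is the
  price for replacing |n| by the square root of \<open>weight\<close>.\<close>

lemma finite_good_approximations_of_symbol:
  fixes a \<mu> :: real
  defines "D \<equiv> (2 * (\<bar>a\<bar> + 2)) powr \<bar>1 - \<mu>\<bar>"
  assumes \<mu>: "0 < \<mu>"
    and fin: "finite {\<xi>. symbol (of_real a) \<xi> \<noteq> 0 \<and>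
      norm (symbol (of_real a) \<xi>) \<le> D * weight \<xi> powr ((1 - \<mu>) / 2)}" (is "finite ?S")
  shows "finite (good_approximations a \<mu>)"
proof (rule finite_subset)
  show "good_approximations a \<mu> \<subseteq> (\<lambda>\<xi>. of_int (fst \<xi>) / of_int (snd \<xi>)) ` ?S"
  proof
    fix q
    assume "q \<in> good_approximations a \<mu>"
    then obtain m n :: int where mn: "n \<noteq> 0" "q = of_int m / of_int n" "0 < \<bar>a - q\<bar>"
      "\<bar>a - q\<bar> < 1 / \<bar>of_int n\<bar> powr \<mu>"
      unfolding good_approximations_def by blast
    let ?n = "\<bar>of_int n :: real\<bar>" and ?p = "\<bar>of_int m - a * of_int n\<bar>"
    have n1: "1 \<le> ?n" using mn(1) by linarith
    have p: "?p = \<bar>a - q\<bar> * ?n"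
      unfolding mn(2) by (rule abs_diff_fraction[OF mn(1)])
    have "?p < 1 / ?n powr \<mu> * ?n"
      unfolding p using mn(1,4) by (intro mult_strict_right_mono) auto
    also have "\<dots> = ?n powr (1 - \<mu>)"
      using mn(1) by (simp add: powr_diff)
    finally have lt: "?p < ?n powr (1 - \<mu>)" .
    \<comment> \<open>This puts (m, n) near the line, where |n| and the square root of
      \<open>weight\<close> are comparable.\<close>
    also have "\<dots> \<le> ?n powr 1"
      using \<mu> by (intro powr_mono n1) simp
    finally have "?p \<le> ?n" using mn(1) by simp
    then have "?n powr (1 - \<mu>) \<le> D * (weight (m, n) powr (1 / 2)) powr (1 - \<mu>)"
      unfolding D_def
      using mn(1) abs_snd_le_sqrt_weight[of "(m, n)"] sqrt_weight_le_near_line[of "(m, n)" a]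
      by (intro powr_comparable(2)) auto
    with lt have "norm (symbol (of_real a) (m, n)) \<le> D * weight (m, n) powr ((1 - \<mu>) / 2)"
      unfolding norm_symbol_of_real weight_powr_half[of _ "1 - \<mu>"] by simp
    moreover have "0 < norm (symbol (of_real a) (m, n))"
      unfolding norm_symbol_of_real using p mn(1,3) by simp
    ultimately show "q \<in> (\<lambda>\<xi>. of_int (fst \<xi>) / of_int (snd \<xi>)) ` ?S"
      by (intro image_eqI[of _ _ "(m, n)"]) (simp_all add: mn(2))
  qed
  show "finite ((\<lambda>\<xi>. of_int (fst \<xi>) / of_int (snd \<xi>)) ` ?S)"
    using fin by simp
qed

section \<open>The indices in the irrational, rational and elliptic cases\<close>

lemma symbol_0 [simp]: "symbol \<alpha> 0 = 0"
  by (simp add: symbol_def)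

text \<open>A positive bound away from the origin confines the zeros of the symbol to the origin, so
  the finiteness condition for GH is automatic.\<close>

lemma GH_GS_of_lower_bound:
  assumes C: "0 < C" and bound: "\<And>\<xi>. \<xi> \<noteq> 0 \<Longrightarrow> C * weight \<xi> powr ((1 - r) / 2) \<le> norm (symbol \<alpha> \<xi>)"
  shows "GH \<alpha> r" "GS \<alpha> r"
proof -
  have "\<xi> = 0" if "symbol \<alpha> \<xi> = 0" for \<xi>
  proof (rule ccontr)
    assume "\<xi> \<noteq> 0"
    moreover have "0 < C * weight \<xi> powr ((1 - r) / 2)"
      using C weight_pos[of \<xi>] by simp
    ultimately show False
      using bound[of \<xi>] that by simp
  qed
  then have "{\<xi>. symbol \<alpha> \<xi> = 0} \<subseteq> {0}"
    by blast
  then have "finite {\<xi>. symbol \<alpha> \<xi> = 0}"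
    by (rule finite_subset) simp
  moreover have "C * weight \<xi> powr ((1 - r) / 2) \<le> norm (symbol \<alpha> \<xi>)" if "symbol \<alpha> \<xi> \<noteq> 0" for \<xi>
    using that bound[of \<xi>] symbol_0[of \<alpha>] by (cases "\<xi> = 0") simp_all
  ultimately show "GH \<alpha> r" "GS \<alpha> r"
    using GH_of_symbol_lower_bound[OF C, of \<alpha> r] GS_of_symbol_lower_bound[OF C, of \<alpha> r] by simp_all
qed

text \<open>A loss \<open>r\<close> yields finiteness only for exponents strictly above
  \<open>r\<close>. The two sets of exponents may therefore differ at the endpoint, and the second
  inequality is proved up to an arbitrary \<open>e\<close>.\<close>

lemma ind_eqI:
  assumes set: "\<And>\<mu>. 0 < \<mu> \<Longrightarrow> finite (good_approximations a \<mu>) \<Longrightarrow> P \<mu>"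
    and lower: "\<And>r \<mu>. 0 \<le> r \<Longrightarrow> P r \<Longrightarrow> r < \<mu> \<Longrightarrow> finite (good_approximations a \<mu>)"
  shows "Inf {ereal r |r. 0 \<le> r \<and> P r} = irrationality_measure a"
proof (rule antisym)
  have irr: "irrationality_measure a = Inf {ereal \<mu> |\<mu>. 0 < \<mu> \<and> finite (good_approximations a \<mu>)}"
    by (simp add: irrationality_measure_def good_approximations_def)
  show "Inf {ereal r |r. 0 \<le> r \<and> P r} \<le> irrationality_measure a"
    unfolding irr
  proof (intro Inf_superset_mono subsetI)
    fix x
    assume "x \<in> {ereal \<mu> |\<mu>. 0 < \<mu> \<and> finite (good_approximations a \<mu>)}"
    then obtain \<mu> where \<mu>: "x = ereal \<mu>" "0 < \<mu>" "finite (good_approximations a \<mu>)" by blast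
    from set[OF \<mu>(2,3)] show "x \<in> {ereal r |r. 0 \<le> r \<and> P r}"
      using \<mu>(1,2) by auto
  qed
  show "irrationality_measure a \<le> Inf {ereal r |r. 0 \<le> r \<and> P r}"
  proof (rule Inf_greatest)
    fix x
    assume "x \<in> {ereal r |r. 0 \<le> r \<and> P r}"
    then obtain r where r: "x = ereal r" "0 \<le> r" "P r" by blast
    show "irrationality_measure a \<le> x"
    proof (rule ereal_le_epsilon2)
      fix e :: real
      assume e: "0 < e"
      then have "finite (good_approximations a (r + e))"
        by (intro lower[OF r(2,3)]) simp
      then have "irrationality_measure a \<le> ereal (r + e)"
        unfolding irr using r(2) e by (intro Inf_lower) auto
      then show "irrationality_measure a \<le> x + ereal e"
        by (simp add: r(1))
    qed
  qed
qed

lemma irrational_index: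
  assumes "a \<notin> \<rat>"
  shows "ind_GH (of_real a) = irrationality_measure a" "ind_GS (of_real a) = irrationality_measure a"
proof -
  have upper: "GH (of_real a) \<mu>" "GS (of_real a) \<mu>"
    if \<mu>: "0 < \<mu>" "finite (good_approximations a \<mu>)" for \<mu>
  proof -
    obtain c where c: "0 < c" "\<And>m n :: int. n \<noteq> 0 \<Longrightarrow> c * \<bar>of_int n\<bar> powr (1 - \<mu>) \<le> \<bar>of_int m - a * of_int n\<bar>"
      using finite_good_approximations_imp_bound[OF assms \<mu>] by blast
    obtain C where C: "0 < C" "\<And>\<xi>. \<xi> \<noteq> 0 \<Longrightarrow> C * weight \<xi> powr ((1 - \<mu>) / 2) \<le> norm (symbol (of_real a) \<xi>)"
      using diophantine_lower_bound[OF \<mu>(1) c] by blast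
    show "GH (of_real a) \<mu>"
      by (rule GH_GS_of_lower_bound(1)[OF C])
    show "GS (of_real a) \<mu>"
      by (rule GH_GS_of_lower_bound(2)[OF C])
  qed
  have GS: "finite (good_approximations a \<mu>)" if "0 \<le> r" "GS (of_real a) r" "r < \<mu>" for r \<mu>
    using that by (intro finite_good_approximations_of_symbol GS_imp_finite_small_symbol) auto
  have GH: "finite (good_approximations a \<mu>)" if "0 \<le> r" "GH (of_real a) r" "r < \<mu>" for r \<mu>
    \<comment> \<open>The finite set obtained from GH also contains the zeros of the symbol, hence
      the passage to a subset.\<close>
    using that(1,3) by (intro finite_good_approximations_of_symbol
        finite_subset[OF _ GH_imp_finite_small_symbol[OF that(2,3)]]) auto
  show "ind_GH (of_real a) = irrationality_measure a" "ind_GS (of_real a) = irrationality_measure a"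
    unfolding ind_GH_def ind_GS_def by (rule ind_eqI; fact upper GH GS)+
qed

text \<open>Liouville's inequality in degree two: a second rational root would make the first one rational as well.\<close>

lemma quadratic_liouville:
  fixes a :: real and A B D :: int
  assumes a: "a \<notin> \<rat>" and A: "A \<noteq> 0" and root: "of_int A * a\<^sup>2 + of_int B * a + of_int D = 0"
  obtains c where "0 < c"
    "\<And>m n :: int. n \<noteq> 0 \<Longrightarrow> c * \<bar>of_int n\<bar> powr (1 - 2) \<le> \<bar>of_int m - a * of_int n\<bar>"
proof
  \<comment> \<open>The first two summands bound the cofactor
    \<open>of_int A * (?q + a) + of_int B\<close> when \<open>?q\<close> is within 1 of
    \<open>a\<close>; the last one gives K \<ge> 1, which settles the fractions farther
    away.\<close>
  define K where "K = \<bar>of_int A\<bar> * (2 * \<bar>a\<bar> + 1) + \<bar>of_int B\<bar> + 1"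
  have K: "1 \<le> K" by (simp add: K_def)
  show "0 < 1 / K" using K by simp
  fix m n :: int
  assume n: "n \<noteq> 0"
  let ?q = "of_int m / of_int n :: real" and ?n = "\<bar>of_int n :: real\<bar>"
  have n1: "1 \<le> ?n" using n by linarith
  have qr: "?q \<in> \<rat>" by simp
  have factor: "of_int A * x\<^sup>2 + of_int B * x + of_int D = (x - a) * (of_int A * (x + a) + of_int B)" for x
  proof -
    have "of_int A * x\<^sup>2 + of_int B * x + of_int D =
        (of_int A * x\<^sup>2 + of_int B * x + of_int D) - (of_int A * a\<^sup>2 + of_int B * a + of_int D)"
      unfolding root by simp
    also have "\<dots> = (x - a) * (of_int A * (x + a) + of_int B)"
      by (simp add: algebra_simps power2_eq_square)
    finally show ?thesis .
  qed
  have "1 / K \<le> \<bar>a - ?q\<bar> * ?n\<^sup>2"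
  proof (cases "\<bar>a - ?q\<bar> \<le> 1")
    case True
    have nz: "of_int A * ?q\<^sup>2 + of_int B * ?q + of_int D \<noteq> 0"
    proof
      assume "of_int A * ?q\<^sup>2 + of_int B * ?q + of_int D = 0"
      then have "of_int A * (?q + a) + of_int B = 0"
        unfolding factor using a qr by auto
      then have "a = - of_int B / of_int A - ?q"
        using A by (simp add: field_simps)
      moreover have "- of_int B / of_int A - ?q \<in> \<rat>"
        by (intro Rats_diff Rats_divide Rats_minus_iff[THEN iffD2] Rats_of_int)
      ultimately show False using a by simp
    qed
    \<comment> \<open>Clearing denominators gives a nonzero integer, of modulus at least 1. The
      factorisation at \<open>a\<close> converts this into a lower bound for the distance from
      \<open>a\<close>.\<close>
    have int: "(of_int A * ?q\<^sup>2 + of_int B * ?q + of_int D) * (of_int n)\<^sup>2 = of_int (A * m\<^sup>2 + B * m * n + D * n\<^sup>2)"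
      using n by (simp add: field_simps power2_eq_square)
    then have "A * m\<^sup>2 + B * m * n + D * n\<^sup>2 \<noteq> 0"
      using nz n by (metis mult_eq_0_iff of_int_0 of_int_eq_0_iff power_eq_0_iff)
    then have "1 \<le> \<bar>real_of_int (A * m\<^sup>2 + B * m * n + D * n\<^sup>2)\<bar>"
      by linarith
    also have "\<dots> = \<bar>?q - a\<bar> * \<bar>of_int A * (?q + a) + of_int B\<bar> * ?n\<^sup>2"
      unfolding int[symmetric] factor by (simp add: abs_mult)
    also have "\<dots> \<le> \<bar>?q - a\<bar> * K * ?n\<^sup>2"
    proof -
      have "\<bar>?q + a\<bar> \<le> 2 * \<bar>a\<bar> + 1" using True by linarith
      then have "\<bar>of_int A\<bar> * \<bar>?q + a\<bar> \<le> \<bar>of_int A\<bar> * (2 * \<bar>a\<bar> + 1)"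
        by (intro mult_left_mono) auto
      then have "\<bar>of_int A * (?q + a) + of_int B\<bar> \<le> K"
        unfolding K_def abs_mult[symmetric] by linarith
      then show ?thesis
        by (intro mult_right_mono mult_left_mono) auto
    qed
    finally show ?thesis
      using K by (simp add: pos_divide_le_eq abs_minus_commute mult_ac)
  next
    case False
    have "1 / K \<le> 1 * 1\<^sup>2" using K by simp
    also have "\<dots> \<le> \<bar>a - ?q\<bar> * ?n\<^sup>2"
      using False n1 by (intro mult_mono power_mono) auto
    finally show ?thesis .
  qed
  then have "1 / K * (1 / ?n) \<le> \<bar>a - ?q\<bar> * ?n\<^sup>2 * (1 / ?n)"
    by (rule mult_right_mono) simp
  also have "\<dots> = \<bar>a - ?q\<bar> * ?n"
    using n by (simp only: power2_eq_square mult.assoc) simp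
  finally show "1 / K * ?n powr (1 - 2) \<le> \<bar>of_int m - a * of_int n\<bar>"
    unfolding abs_diff_fraction[OF n] using n by (simp add: powr_minus_divide)
qed

text \<open>Algebraicity makes the set of degrees nonempty, so \<open>LEAST\<close> is attained by a
  polynomial; its leading coefficient is the nonzero \<open>A\<close>.\<close>

lemma algebraic_degree_2_imp_quadratic:
  assumes "algebraic (of_real a :: complex)" "algebraic_degree (of_real a) = 2"
  obtains A B D :: int where "A \<noteq> 0" "of_int A * a\<^sup>2 + of_int B * a + of_int D = 0"
proof -
  let ?P = "\<lambda>d. \<exists>p :: int poly. p \<noteq> 0 \<and> poly (map_poly of_int p) (of_real a :: complex) = 0 \<and> degree p = d"
  obtain p :: "int poly" where "p \<noteq> 0" "poly (map_poly of_int p) (of_real a :: complex) = 0"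
    using assms(1) by (rule algebraicE')
  then have "?P (LEAST d. ?P d)"
    by (intro LeastI[of ?P "degree p"]) blast
  then obtain p :: "int poly" where p: "poly (map_poly of_int p) (of_real a :: complex) = 0" "degree p = 2"
    using assms(2) unfolding algebraic_degree_def by auto
  have deg: "degree (map_poly of_int p :: complex poly) = 2"
    using p(2) by (simp add: degree_map_poly)
  have "of_real (of_int (coeff p 2) * a\<^sup>2 + of_int (coeff p 1) * a + of_int (coeff p 0)) = (0 :: complex)"
    using p(1) unfolding poly_altdef deg by (simp add: numeral_2_eq_2 coeff_map_poly algebra_simps)
  then have "of_int (coeff p 2) * a\<^sup>2 + of_int (coeff p 1) * a + of_int (coeff p 0) = 0"
    by (simp only: of_real_eq_0_iff)
  moreover have "coeff p 2 \<noteq> 0"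
    using p(2) leading_coeff_0_iff[of p] by auto
  ultimately show thesis by (rule that[rotated])
qed

lemma quadratic_GH_GS_2:
  assumes "a \<notin> \<rat>" "algebraic (of_real a :: complex)" "algebraic_degree (of_real a) = 2"
  shows "GH (of_real a) 2" "GS (of_real a) 2"
proof -
  obtain A B D :: int where "A \<noteq> 0" "of_int A * a\<^sup>2 + of_int B * a + of_int D = 0"
    using assms(2,3) by (rule algebraic_degree_2_imp_quadratic)
  then obtain c where c: "0 < c"
    "\<And>m n :: int. n \<noteq> 0 \<Longrightarrow> c * \<bar>of_int n\<bar> powr (1 - 2) \<le> \<bar>of_int m - a * of_int n\<bar>"
    using quadratic_liouville[OF assms(1)] by blast
  obtain C where C: "0 < C" "\<And>\<xi>. \<xi> \<noteq> 0 \<Longrightarrow> C * weight \<xi> powr ((1 - 2) / 2) \<le> norm (symbol (of_real a) \<xi>)"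
    using diophantine_lower_bound[OF _ c] by auto
  show "GH (of_real a) 2"
    by (rule GH_GS_of_lower_bound(1)[OF C])
  show "GS (of_real a) 2"
    by (rule GH_GS_of_lower_bound(2)[OF C])
qed

text \<open>For \<alpha> = p / q the symbol takes values in \<i> / q times the integers, so nonzero
  values are at least 1 / q in modulus: a loss of 1. On each translate of the multiples of (p, q) it
  is constant. The value 0 occurs infinitely often and excludes GH, while the value \<i> occurs
  infinitely often and excludes GS with a smaller loss.\<close>

lemma rational_GH_GS:
  assumes "\<alpha> \<in> \<rat>"
  shows "ind_GH \<alpha> = \<infinity>" "ind_GS \<alpha> = 1" "GS \<alpha> 1"
proof -
  obtain p q :: int where q: "0 < q" and \<alpha>: "\<alpha> = of_int p / of_int q"
    using assms by (rule Rats_cases')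
  have mult: "symbol \<alpha> \<xi> * of_int q = \<i> * of_int (fst \<xi> * q - p * snd \<xi>)" for \<xi>
    using q by (simp add: symbol_def \<alpha> field_simps)
  have inj: "inj (\<lambda>j :: int. (i + j * p, j * q))" for i :: int
    using q by (auto simp: inj_on_def)
  have infinite_range: "infinite (range (\<lambda>j. (i + j * p, j * q)))" for i
    using inj by (simp add: finite_image_iff)
  have infinite: "infinite S" if "\<And>j. (i + j * p, j * q) \<in> S" for i S
    using finite_subset[of "range (\<lambda>j. (i + j * p, j * q))" S] that infinite_range by blast
  have line: "symbol \<alpha> (i + j * p, j * q) = \<i> * of_int i" for i j
    using q by (simp add: symbol_def \<alpha> field_simps)
  have "\<not> GH \<alpha> r" for r
  proof
    assume "GH \<alpha> r"
    from GH_imp_finite_small_symbol[OF this, of "r + 1" 1] show False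
      using infinite[of 0 "{\<xi>. norm (symbol \<alpha> \<xi>) \<le> 1 * weight \<xi> powr ((1 - (r + 1)) / 2)}"] line[of 0]
      by simp
  qed
  then show "ind_GH \<alpha> = \<infinity>"
    by (simp add: ind_GH_def top_ereal_def)
  show GS1: "GS \<alpha> 1"
  proof (rule GS_of_symbol_lower_bound)
    show "0 < 1 / real_of_int q" using q by simp
    fix \<xi>
    assume nz: "symbol \<alpha> \<xi> \<noteq> 0"
    then have "\<i> * of_int (fst \<xi> * q - p * snd \<xi>) \<noteq> (0 :: complex)"
      using q unfolding mult[symmetric] by simp
    then have "fst \<xi> * q - p * snd \<xi> \<noteq> 0"
      by (rule contrapos_nn) (simp only: of_int_0 mult_zero_right)
    then have "1 \<le> \<bar>real_of_int (fst \<xi> * q - p * snd \<xi>)\<bar>"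
      by linarith
    also have "\<dots> = norm (\<i> * of_int (fst \<xi> * q - p * snd \<xi>))"
      unfolding norm_mult norm_of_int by simp
    also have "\<dots> = norm (symbol \<alpha> \<xi>) * of_int q"
      unfolding mult[symmetric] using q by (simp add: norm_mult)
    finally show "1 / real_of_int q * weight \<xi> powr ((1 - 1) / 2) \<le> norm (symbol \<alpha> \<xi>)"
      using q weight_pos[of \<xi>] by (simp add: field_simps)
  qed
  show "ind_GS \<alpha> = 1"
  proof (rule antisym)
    show "ind_GS \<alpha> \<le> 1"
      unfolding ind_GS_def by (rule Inf_lower) (use GS1 in \<open>auto simp: one_ereal_def\<close>)
    show "1 \<le> ind_GS \<alpha>"
      unfolding ind_GS_def
    proof (rule Inf_greatest)
      fix x
      assume "x \<in> {ereal r |r. 0 \<le> r \<and> GS \<alpha> r}"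
      then obtain r where r: "x = ereal r" "GS \<alpha> r" by blast
      have "1 \<le> r"
      proof (rule ccontr)
        assume "\<not> 1 \<le> r"
        \<comment> \<open>With r' = 1 the exponent is 0 and the threshold is 1, the modulus of the
          symbol on the translate starting at (1, 0).\<close>
        then have "finite {\<xi>. symbol \<alpha> \<xi> \<noteq> 0 \<and> norm (symbol \<alpha> \<xi>) \<le> 1 * weight \<xi> powr ((1 - 1) / 2)}"
          by (intro GS_imp_finite_small_symbol[OF r(2)]) simp
        then show False
          using infinite[of 1 "{\<xi>. symbol \<alpha> \<xi> \<noteq> 0 \<and> norm (symbol \<alpha> \<xi>) \<le> 1 * weight \<xi> powr ((1 - 1) / 2)}"]
            line[of 1] by (simp add: less_imp_neq[OF weight_pos, symmetric])
      qed
      then show "1 \<le> x"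
        by (simp add: r(1) one_ereal_def)
    qed
  qed
qed

lemma elliptic_GH_GS:
  assumes "Im \<alpha> \<noteq> 0"
  shows "GH \<alpha> 0" "GS \<alpha> 0" "ind_GH \<alpha> = 0" "ind_GS \<alpha> = 0"
proof -
  obtain C where C: "0 < C" "\<And>\<xi>. \<xi> \<noteq> 0 \<Longrightarrow> C * weight \<xi> powr ((1 - 0) / 2) \<le> norm (symbol \<alpha> \<xi>)"
    using elliptic_lower_bound[OF assms] by auto
  show GH: "GH \<alpha> 0"
    by (rule GH_GS_of_lower_bound(1)[OF C])
  show GS: "GS \<alpha> 0"
    by (rule GH_GS_of_lower_bound(2)[OF C])
  have "Inf {ereal r |r. 0 \<le> r \<and> P r} = 0" if "P 0" for P
    by (rule antisym, rule Inf_lower) (use that in \<open>auto simp: zero_ereal_def intro!: Inf_greatest\<close>)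
  then show "ind_GH \<alpha> = 0" "ind_GS \<alpha> = 0"
    unfolding ind_GH_def ind_GS_def using GH GS by blast+
qed

theorem theorem4p10:
  fixes \<alpha> :: complex
  shows "(Im \<alpha> \<noteq> 0 \<longrightarrow>
            ind_GH \<alpha> = 0 \<and> ind_GS \<alpha> = 0 \<and> GH \<alpha> 0 \<and> GS \<alpha> 0) \<and>
         (\<alpha> \<in> \<rat> \<longrightarrow>
            ind_GH \<alpha> = \<infinity> \<and> ind_GS \<alpha> = 1 \<and> GS \<alpha> 1) \<and>
         (\<alpha> \<in> \<real> - \<rat> \<longrightarrow>
            ind_GH \<alpha> = irrationality_measure (Re \<alpha>) \<and>
            ind_GS \<alpha> = irrationality_measure (Re \<alpha>) \<and>
            (algebraic \<alpha> \<and> algebraic_degree \<alpha> = 2 \<longrightarrow> GH \<alpha> 2 \<and> GS \<alpha> 2))"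
proof (intro conjI impI)
  assume "Im \<alpha> \<noteq> 0"
  then show "ind_GH \<alpha> = 0" "ind_GS \<alpha> = 0" "GH \<alpha> 0" "GS \<alpha> 0"
    by (rule elliptic_GH_GS)+
next
  assume "\<alpha> \<in> \<rat>"
  then show "ind_GH \<alpha> = \<infinity>" "ind_GS \<alpha> = 1" "GS \<alpha> 1"
    by (rule rational_GH_GS)+
next
  assume \<alpha>: "\<alpha> \<in> \<real> - \<rat>"
  then have eq: "of_real (Re \<alpha>) = \<alpha>"
    by (simp add: of_real_Re)
  have irr: "Re \<alpha> \<notin> \<rat>"
  proof
    assume "Re \<alpha> \<in> \<rat>"
    then obtain m n :: int where "Re \<alpha> = of_int m / of_int n" by (rule Rats_cases')
    then have "\<alpha> = of_int m / of_int n" using eq[symmetric] by simp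
    then show False using \<alpha> by simp
  qed
  show "ind_GH \<alpha> = irrationality_measure (Re \<alpha>)" "ind_GS \<alpha> = irrationality_measure (Re \<alpha>)"
    using irrational_index[OF irr] by (simp_all add: eq)
  assume "algebraic \<alpha> \<and> algebraic_degree \<alpha> = 2"
  then show "GH \<alpha> 2" "GS \<alpha> 2"
    using quadratic_GH_GS_2[OF irr] by (simp_all add: eq)
qed

end
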